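(* Let $n,p$ be positive integers with $p \ge n$, let $X\in\mathbb{R}^{n\times p}$ have columns normalized so that $\|X_j\|_2=\sqrt n$ for all $1\le j\le p$, and let $y = X\beta_\star+z$ with $z\sim\mathcal{N}(0,\sigma^2 I_n)$, where $\beta_\star$ has support $J_\star$ of size $s_\star$ with $1\le s_\star\le\overline{s}$. Let $\varepsilon>0$ and $c\ge1$, and suppose that Condition $\mathbf{I}((2+\varepsilon)s_\star)$ holds, that the sparsity parameter of the prior is $$\lambda=\frac{(1+\varepsilon)(23+5c)+1}{\varepsilon}\log p,$$ and that $$\min_{j\in J_\star}|\beta_{\star,j}|\ge\frac{3\sigma\sqrt{\lambda/n}}{\nu_{(2+\varepsilon)s_\star}}.$$ Then the following hold. (1) With probability at least $1-4p^{-c}$, $$\|\widetilde\beta-\beta_\star\|_\infty\le\sigma\sqrt{\frac{2(c+1)\log p}{n\nu_{s_\star}^2}}+\frac{3}{\nu_{\min}\,p^c}\left[\sigma\sqrt{(20+4c)\frac{\log p}{n}}+\frac{\|X\beta_\star\|_2}{\sqrt n}+\nu_{\min}\|\beta_\star\|_\infty\right].$$ (2) If in addition $\mathbf{I}(\overline{s})$ is satisfied, then with probability at least $1-4p^{-c}$, $$\|\widehat\beta_{\rm mean}-\beta_\star\|_\infty\le\sigma\sqrt{\frac{2(c+1)\log p}{n\nu_{s_\star}^2}}+\frac{3}{\nu_{\overline{s}}\,p^c}\left[\sigma\sqrt{(20+4c)\frac{\log p}{n}}+\frac{\|X\beta_\star\|_2}{\sqrt n}+\nu_{\overline{s}}\|\beta_\star\|_\infty\right].$$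 (3) If in addition $\mathbf{I}(s_\star+\overline{s})$ is satisfied and $\lambda\ge(62+4c)\log p$, then with probability at least $1-4p^{-c}$, $$\|\widehat\beta_{\rm mean}-\beta_\star\|_\infty\le\sigma\sqrt{\frac{2(c+1)\log p}{n\nu_{s_\star}^2}}+\frac{2\sqrt{10}\,\sigma}{\sqrt n\,\nu_{s_\star+\overline{s}}}\left[\frac{2\sqrt{s_\star}}{p^c}+\frac1{p^{s_\star}}\right].$$
   Context: Model: $y=X\beta_\star+z\in\mathbb{R}^n$ with $X\in\mathbb{R}^{n\times p}$ deterministic, $z\sim\mathcal{N}(0,\sigma^2 I_n)$ and $\sigma>0$ known. The vector $\beta_\star\in\mathbb{R}^p$ is one of the vectors $\beta$ of minimal support size among those satisfying $X\beta=\mathbb{E}(y)$; $J_\star\subset[p]:=\{1,\dots,p\}$ is its support and $s_\star=|J_\star|$. $\|\cdot\|_2$ is the Euclidean norm and $\|u\|_\infty=\max_j|u_j|$. For $J\subset[p]$, $X_J$ is the submatrix of $X$ with columns $X_j$, $j\in J$; $P_J$ is the orthogonal projection of $\mathbb{R}^n$ onto the span of $\{X_j: j\in J\}$, and $P_J^\perp=I_n-P_J$. Prior and pseudo-posterior: fix an integer upper bound $\overline{s}\le p$ on the support size (with $s_\star\le\overline{s}$) and a parameter $\lambda>0$. The prior on subsets $J\subset[p]$ is the probability distribution $\pi(J)\propto\binom{p}{|J|}^{-1}e^{-\lambda|J|}\mathbf{1}_{\{|J|\le\overline{s}\}}$, and the pseudo-posterior is the probability distribution $\Pi(J)\propto\pi(J)\exp\left(-\frac{\|P_J^\perp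 y\|_2^2}{2\sigma^2}\right)$. Condition $\mathbf{I}(s)$ (for real $s\ge1$): for every $J\subset[p]$ with $|J|\le s$, $X_J$ has full column rank. For nonempty $J\subset[p]$ and real $s\ge1$, $$\nu_J=\min_{u\in\mathbb{R}^{|J|},\,\|u\|_2=1}\frac1{\sqrt n}\|X_Ju\|_2,\qquad \nu_s=\min_{J\subset[p],\,1\le|J|\le s}\nu_J,\qquad \nu_{\min}=\min_{J\subset[p]:\,\nu_J>0}\nu_J>0.$$ Condition $\mathbf{I}(s)$ is equivalent to $\nu_s>0$. Estimators: for $J\subset[p]$, $\widehat\beta_J$ is the minimum-Euclidean-norm least squares coefficient vector for regressing $y$ on $X_J$, viewed as a vector of $\mathbb{R}^p$ by setting coordinates outside $J$ to $0$ (so $\widehat\beta_\emptyset=0$). Then $\widehat\beta_{\rm mean}=\sum_{J\subset[p]}\Pi(J)\widehat\beta_J$ and $\widetilde\beta=\sum_{J\subset[p]:\,\nu_J>0}\Pi(J)\widehat\beta_J$. *)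

theory Defs
  imports "HOL-Probability.Probability"
begin

definition supp :: "real^'p \<Rightarrow> 'p set" where
  "supp b = {j. b $ j \<noteq> 0}"

(* The submatrix of X with columns in J is represented by zeroing the columns outside J, and
   a coefficient vector indexed by J is represented by a vector u with supp u \<subseteq> J.
   The zero columns do not contribute to the rank. *)
definition submat :: "real^'p^'n \<Rightarrow> 'p set \<Rightarrow> real^'p^'n" where
  "submat X J = (\<chi> i j. if j \<in> J then X $ i $ j else 0)"

definition orth_proj :: "'a::euclidean_space set \<Rightarrow> 'a \<Rightarrow> 'a" where
  "orth_proj S v = (THE w. w \<in> S \<and> (\<forall>x\<in>S. orthogonal (v - w) x))"

definition resid :: "real^'p^'n \<Rightarrow> 'p set \<Rightarrow> real^'n \<Rightarrow> real^'n" where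
  "resid X J v = v - orth_proj (span ((\<lambda>j. column j X) ` J)) v"

definition sparsest_solution :: "real^'p^'n \<Rightarrow> real^'n \<Rightarrow> real^'p \<Rightarrow> bool" where
  "sparsest_solution X m b \<longleftrightarrow> is_arg_min (\<lambda>b. card (supp b)) (\<lambda>b. X *v b = m) b"

(* z ~ N(0, sigma^2 I_n), given by its independent coordinates; the second argument of
   normal_density is the standard deviation. *)
definition isotropic_gaussian :: "'a measure \<Rightarrow> ('a \<Rightarrow> real^'n) \<Rightarrow> real \<Rightarrow> bool" where
  "isotropic_gaussian M z \<sigma> \<longleftrightarrow>
     prob_space.indep_vars M (\<lambda>_. borel) (\<lambda>i \<omega>. z \<omega> $ i) UNIV \<and>
     (\<forall>i. distributed M lborel (\<lambda>\<omega>. z \<omega> $ i) (\<lambda>x. ennreal (normal_density 0 \<sigma> x)))"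

definition cond_I :: "real^'p^'n \<Rightarrow> real \<Rightarrow> bool" where
  "cond_I X s \<longleftrightarrow> (\<forall>J. real (card J) \<le> s \<longrightarrow> rank (submat X J) = card J)"

(* Meant for nonempty J: the infimum is then over a nonempty compact set, hence a minimum. *)
definition nu_set :: "real^'p^'n \<Rightarrow> 'p set \<Rightarrow> real" where
  "nu_set X J =
     (INF u\<in>{u. supp u \<subseteq> J \<and> norm u = 1}. norm (submat X J *v u) / sqrt (real CARD('n)))"

definition nu :: "real^'p^'n \<Rightarrow> real \<Rightarrow> real" where
  "nu X s = Min (nu_set X ` {J. 1 \<le> card J \<and> real (card J) \<le> s})"

definition nu_min :: "real^'p^'n \<Rightarrow> real" where
  "nu_min X = Min (nu_set X ` {J. J \<noteq> {} \<and> nu_set X J > 0})"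

definition prior_weight :: "real \<Rightarrow> nat \<Rightarrow> 'p::finite set \<Rightarrow> real" where
  "prior_weight lam sbar J =
     (if card J \<le> sbar then exp (- lam * real (card J)) / real (CARD('p) choose card J) else 0)"

definition prior :: "real \<Rightarrow> nat \<Rightarrow> 'p::finite set \<Rightarrow> real" where
  "prior lam sbar J = prior_weight lam sbar J / (\<Sum>K\<in>UNIV. prior_weight lam sbar (K :: 'p set))"

definition post_weight ::
  "real^'p^'n \<Rightarrow> real \<Rightarrow> real \<Rightarrow> nat \<Rightarrow> real^'n \<Rightarrow> 'p set \<Rightarrow> real" where
  "post_weight X \<sigma> lam sbar y J =
     prior lam sbar J * exp (- ((norm (resid X J y))\<^sup>2 / (2 * \<sigma>\<^sup>2)))"

definition posterior ::
  "real^'p^'n \<Rightarrow> real \<Rightarrow> real \<Rightarrow> nat \<Rightarrow> real^'n \<Rightarrow> 'p set \<Rightarrow> real" where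
  "posterior X \<sigma> lam sbar y J =
     post_weight X \<sigma> lam sbar y J / (\<Sum>K\<in>UNIV. post_weight X \<sigma> lam sbar y K)"

definition least_squares :: "real^'p^'n \<Rightarrow> 'p set \<Rightarrow> real^'n \<Rightarrow> real^'p \<Rightarrow> bool" where
  "least_squares X J y b \<longleftrightarrow>
     is_arg_min (\<lambda>b. norm (y - submat X J *v b)) (\<lambda>b. supp b \<subseteq> J) b"

definition beta_hat :: "real^'p^'n \<Rightarrow> 'p set \<Rightarrow> real^'n \<Rightarrow> real^'p" where
  "beta_hat X J y = (THE b. is_arg_min norm (least_squares X J y) b)"

definition beta_mean :: "real^'p^'n \<Rightarrow> real \<Rightarrow> real \<Rightarrow> nat \<Rightarrow> real^'n \<Rightarrow> real^'p" where
  "beta_mean X \<sigma> lam sbar y =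
     (\<Sum>J\<in>UNIV. posterior X \<sigma> lam sbar y J *\<^sub>R beta_hat X J y)"

(* nu_set is meaningful for nonempty J only; the empty set would contribute the zero vector. *)
definition beta_tilde :: "real^'p^'n \<Rightarrow> real \<Rightarrow> real \<Rightarrow> nat \<Rightarrow> real^'n \<Rightarrow> real^'p" where
  "beta_tilde X \<sigma> lam sbar y =
     (\<Sum>J | J \<noteq> {} \<and> nu_set X J > 0. posterior X \<sigma> lam sbar y J *\<^sub>R beta_hat X J y)"

end

(* With S the support of beta, v_J the part of X beta orthogonal to the columns in J, and d(J) the
   size of the symmetric difference of J and S, the log posterior ratio of J and S is controlled on an
   event defined by four families of inequalities for the noise z: linear functionals <v_J, z>
   (Chernoff), increments |P_(S u R) z|^2 - |P_S z|^2 (exponential moments of Gaussian quadratic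
   forms), |P_S z|^2, and the coordinates of the least squares error on S; union bounds over J and R
   cost a factor p per element and the event has probability at least 1 - 4 p^(-c).  On it every
   J <> S satisfies
     Pi(J) <= p^(-(1 + 4c/3)) p^(-4 d(J)) exp(-|v_J|^2 / (16 sigma^2)).
   If J has at most (1 + epsilon) s false elements, each missed element of S contributes
   9 lambda sigma^2 to |v_J|^2 by the beta-min condition; otherwise the prior penalty
   lambda |J - S| alone outweighs everything, because lambda epsilon / (1 + epsilon) exceeds
   (23 + 5c) log p.  Summing over J, the posterior mean differs from the least squares estimator
   on S by terms of order p^(-c). *)
theory Submission
  imports Defs
begin

section \<open>Projections, design matrices and least squares\<close>

text \<open>Comparing \<open>J\<close> with \<open>S\<close> alone already bounds the posterior of
  \<open>J\<close>, so no normalizing sum is ever estimated. Each factor of the bound on Pi(J) has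
  its own task. The factor p^(-4 d(J)) makes the sum over all supports small although at most p^d of
  them lie at distance d. The factor p^(-(1 + 4c/3)) spends one power of p on the crude bound p
  sigma sqrt((20 + 4c) log p) for |P_J z|, which is uniform in J; its surplus p^(-c/3) over p^(-c)
  absorbs sqrt(20 + 4c) in (3), where the conclusion has no such term. The exponential in |v_J|^2
  pays for |v_J| itself in (3), where |X beta| must not appear either. On the probabilistic side the
  obstacle is to bound squared projections at a cost of at most a factor p per column. This rests on
  E exp(3 g^2 / 8) = 2 for a standard normal g: the exponent 3/8 makes each dimension cost exactly
  2, which is at most p. All three statements hold on the same event.\<close>

lemma orth_proj_unique:
  assumes "subspace S" "w \<in> S" "\<And>x. x \<in> S \<Longrightarrow> orthogonal (v - w) x"
  shows "orth_proj S v = w"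
  unfolding orth_proj_def
proof (rule the_equality)
  fix w' assume w': "w' \<in> S \<and> (\<forall>x\<in>S. orthogonal (v - w') x)"
  have "w' - w \<in> S" using w' assms by (simp add: subspace_diff)
  then have "orthogonal (v - w) (w' - w)" "orthogonal (v - w') (w' - w)" using w' assms by auto
  then have "(w' - w) \<bullet> (w' - w) = 0"
    unfolding orthogonal_def by (simp add: inner_diff_left inner_diff_right inner_commute)
  then show "w' = w" by simp
qed (use assms in auto)

lemma
  assumes "subspace S" shows orth_proj_mem: "orth_proj S v \<in> S"
    and orth_proj_orthogonal: "x \<in> S \<Longrightarrow> orthogonal (v - orth_proj S v) x"
proof -
  have sp: "span S = S" using assms by (simp add: span_eq_iff)
  obtain a b where ab: "a \<in> span S" "\<And>w. w \<in> span S \<Longrightarrow> orthogonal b w" "v = a + b"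
    using orthogonal_subspace_decomp_exists by blast
  have e: "orth_proj S v = a"
    by (rule orth_proj_unique[OF assms]) (use ab sp in auto)
  show "orth_proj S v \<in> S" using e ab sp by auto
  show "orthogonal (v - orth_proj S v) x" if "x \<in> S" using e ab sp that by auto
qed

lemma orth_proj_id: "subspace S \<Longrightarrow> v \<in> S \<Longrightarrow> orth_proj S v = v"
  by (rule orth_proj_unique) (auto simp: orthogonal_def)

lemma linear_orth_proj:
  assumes "subspace S" shows "linear (orth_proj S)"
proof (rule linearI)
  fix x y :: 'a and r :: real
  show "orth_proj S (x + y) = orth_proj S x + orth_proj S y"
  proof (rule orth_proj_unique[OF assms])
    fix u assume "u \<in> S"
    then show "orthogonal (x + y - (orth_proj S x + orth_proj S y)) u"
      using orth_proj_orthogonal[OF assms, of u x] orth_proj_orthogonal[OF assms, of u y]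
      by (auto simp: orthogonal_def inner_diff_left inner_add_left)
  qed (use assms in \<open>auto intro!: subspace_add orth_proj_mem\<close>)
  show "orth_proj S (r *\<^sub>R x) = r *\<^sub>R orth_proj S x"
  proof (rule orth_proj_unique[OF assms])
    fix u assume "u \<in> S"
    then show "orthogonal (r *\<^sub>R x - r *\<^sub>R orth_proj S x) u"
      using orth_proj_orthogonal[OF assms, of u x]
      by (auto simp: orthogonal_def inner_diff_left)
  qed (use assms in \<open>auto intro!: subspace_scale orth_proj_mem\<close>)
qed

lemma norm_orth_proj_pythagoras:
  assumes "subspace S" shows "(norm v)\<^sup>2 = (norm (orth_proj S v))\<^sup>2 + (norm (v - orth_proj S v))\<^sup>2"
proof -
  have "orthogonal (v - orth_proj S v) (orth_proj S v)"
    by (intro orth_proj_orthogonal orth_proj_mem assms)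
  then have "orthogonal (orth_proj S v) (v - orth_proj S v)" by (simp add: orthogonal_commute)
  from norm_add_Pythagorean[OF this] show ?thesis by simp
qed

lemma orth_proj_dist_pythagoras:
  assumes "subspace S" "x \<in> S"
  shows "(norm (v - x))\<^sup>2 = (norm (v - orth_proj S v))\<^sup>2 + (norm (orth_proj S v - x))\<^sup>2"
proof -
  have "orthogonal (v - orth_proj S v) (orth_proj S v - x)"
    by (intro orth_proj_orthogonal subspace_diff orth_proj_mem assms)
  from norm_add_Pythagorean[OF this] show ?thesis by simp
qed

lemma norm_orth_proj_le:
  assumes "subspace S" shows "norm (orth_proj S v) \<le> norm v"
  by (rule power2_le_imp_le) (use norm_orth_proj_pythagoras[OF assms, of v] in auto)

lemma orth_proj_orth_proj:
  assumes "subspace S" "subspace T" "S \<subseteq> T"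
  shows "orth_proj S (orth_proj T v) = orth_proj S v"
proof (rule orth_proj_unique[symmetric, OF assms(1)])
  show "orth_proj S (orth_proj T v) \<in> S" by (intro orth_proj_mem assms)
  fix x assume x: "x \<in> S"
  then have "orthogonal (v - orth_proj T v) x" using orth_proj_orthogonal assms by blast
  moreover have "orthogonal (orth_proj T v - orth_proj S (orth_proj T v)) x"
    using x orth_proj_orthogonal assms by blast
  ultimately show "orthogonal (v - orth_proj S (orth_proj T v)) x"
    by (auto simp: orthogonal_def inner_diff_left)
qed

lemma norm_orth_proj_mono:
  assumes "subspace S" "subspace T" "S \<subseteq> T"
  shows "norm (orth_proj S v) \<le> norm (orth_proj T v)"
  using norm_orth_proj_le[OF assms(1), of "orth_proj T v"] orth_proj_orth_proj[OF assms] by simp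

lemma inner_orth_proj:
  assumes "subspace S" "x \<in> S" shows "orth_proj S v \<bullet> x = v \<bullet> x"
  using orth_proj_orthogonal[OF assms, of v] by (simp add: orthogonal_def inner_diff_left)

text \<open>The increment is the squared norm of the projection onto the orthogonal complement of
  \<open>S\<close> in \<open>T\<close>.\<close>
lemma orth_proj_increment:
  fixes S T :: "'a::euclidean_space set"
  assumes "subspace S" "subspace T" "S \<subseteq> T"
  obtains B where "finite B" "pairwise orthogonal B" "\<And>b. b \<in> B \<Longrightarrow> norm b = 1"
    "card B + dim S = dim T"
    "\<And>v. (norm (orth_proj T v))\<^sup>2 - (norm (orth_proj S v))\<^sup>2 = (\<Sum>b\<in>B. (b \<bullet> v)\<^sup>2)"
proof -
  define V where "V = {y \<in> T. \<forall>x \<in> S. orthogonal x y}"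
  have V: "subspace V" unfolding V_def subspace_def
    using assms(2) by (auto simp: subspace_add subspace_scale subspace_0 orthogonal_def inner_add_right)
  obtain B where B: "B \<subseteq> V" "pairwise orthogonal B" "\<And>x. x \<in> B \<Longrightarrow> norm x = 1"
    "independent B" "card B = dim V" "span B = V"
    using orthonormal_basis_subspace[OF V] by metis
  have fin: "finite B" using B(4) by (simp add: independent_imp_finite)
  show ?thesis
  proof
    show "card B + dim S = dim T"
      using dim_subspace_orthogonal_to_vectors[OF assms] B(5) V_def by simp
    fix v
    define w where "w = orth_proj T v - orth_proj S v"
    have "w \<in> T" unfolding w_def using assms by (meson orth_proj_mem subspace_diff subsetD)
    moreover have oS: "orthogonal x w" if "x \<in> S" for x
      using orth_proj_orthogonal[OF assms(1) that, of v] orth_proj_orthogonal[OF assms(2), of x v] that assms(3)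
      by (auto simp: w_def orthogonal_def inner_diff_left inner_diff_right inner_commute)
    ultimately have wV: "w \<in> span B" using B(6) V_def by auto
    have "orthogonal (orth_proj S v) w" by (intro oS orth_proj_mem assms)
    from norm_add_Pythagorean[OF this]
    have "(norm (orth_proj T v))\<^sup>2 - (norm (orth_proj S v))\<^sup>2 = (norm w)\<^sup>2" by (simp add: w_def)
    also have "\<dots> = (\<Sum>b\<in>B. (b \<bullet> w)\<^sup>2)"
    proof -
      \<comment> \<open>Parseval for \<open>B\<close>: the remainder of the expansion is orthogonal
        to the whole span of \<open>B\<close>, and \<open>w\<close> lies in that span.\<close>
      have "orthogonal w (w - (\<Sum>b\<in>B. (b \<bullet> w / (b \<bullet> b)) *\<^sub>R b))"
        by (rule Gram_Schmidt_step[OF B(2) wV])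
      then have "w \<bullet> w = w \<bullet> (\<Sum>b\<in>B. (b \<bullet> w / (b \<bullet> b)) *\<^sub>R b)"
        by (simp add: orthogonal_def inner_diff_right)
      also have "\<dots> = (\<Sum>b\<in>B. (b \<bullet> w)\<^sup>2)"
        by (simp add: inner_sum_right power2_eq_square inner_commute B(3)[unfolded norm_eq_1])
      finally show ?thesis by (simp add: power2_norm_eq_inner)
    qed
    also have "\<dots> = (\<Sum>b\<in>B. (b \<bullet> v)\<^sup>2)"
    proof (intro sum.cong refl)
      fix b assume "b \<in> B"
      then have b: "b \<in> T" "\<And>x. x \<in> S \<Longrightarrow> orthogonal x b" using B(1) V_def by auto
      have "b \<bullet> orth_proj S v = 0"
        using b(2)[OF orth_proj_mem[OF assms(1), of v]] by (simp add: orthogonal_def inner_commute)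
      then show "(b \<bullet> w)\<^sup>2 = (b \<bullet> v)\<^sup>2"
        using inner_orth_proj[OF assms(2) b(1), of v] by (simp add: w_def inner_diff_right inner_commute)
    qed
    finally show "(norm (orth_proj T v))\<^sup>2 - (norm (orth_proj S v))\<^sup>2 = (\<Sum>b\<in>B. (b \<bullet> v)\<^sup>2)" .
  qed (use B fin in auto)
qed

section \<open>Column spans and injectivity on a support\<close>

abbreviation colspan :: "real^'p^'n \<Rightarrow> 'p set \<Rightarrow> (real^'n) set" where
  "colspan X J \<equiv> span ((\<lambda>j. column j X) ` J)"

text \<open>Full column rank of \<open>submat X J\<close>, stated as a trivial kernel on the vectors
  supported in \<open>J\<close>. The rank condition and the condition \<open>nu_set X J > 0\<close>
  are each converted to this form once.\<close>

definition inj_cols :: "real^'p^'n \<Rightarrow> 'p set \<Rightarrow> bool" where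
  "inj_cols X J \<longleftrightarrow> (\<forall>u. supp u \<subseteq> J \<longrightarrow> X *v u = 0 \<longrightarrow> u = 0)"

lemma supp_subset_iff: "supp u \<subseteq> J \<longleftrightarrow> (\<forall>j. j \<notin> J \<longrightarrow> u $ j = 0)"
  by (auto simp: supp_def)

lemma supp_diff_subset: "supp (a - b) \<subseteq> supp a \<union> supp b"
  by (auto simp: supp_def)

lemma submat_mult:
  assumes "supp u \<subseteq> J" shows "submat X J *v u = X *v u"
  using assms by (auto simp: vec_eq_iff matrix_vector_mult_def submat_def supp_subset_iff intro!: sum.cong)

lemma mult_in_colspan:
  assumes "supp u \<subseteq> J" shows "X *v u \<in> colspan X J"
proof -
  have "X *v u = (\<Sum>j\<in>UNIV. u $ j *\<^sub>R column j X)"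
    by (simp add: matrix_mult_sum scalar_mult_eq_scaleR)
  also have "\<dots> \<in> colspan X J"
  proof (intro span_sum)
    fix j show "u $ j *\<^sub>R column j X \<in> colspan X J"
      using assms by (cases "j \<in> J") (auto simp: supp_subset_iff span_base span_scale span_zero)
  qed
  finally show ?thesis .
qed

lemma colspanE:
  fixes X :: "real^'p^'n"
  assumes "x \<in> colspan X J" obtains u where "supp u \<subseteq> J" "x = X *v u"
proof -
  have "colspan X J \<subseteq> (\<lambda>u. X *v u) ` {u. supp u \<subseteq> J}"
  proof (rule span_minimal)
    have "subspace {u :: real^'p. supp u \<subseteq> J}"
      by (auto simp: supp_subset_iff subspace_def)
    then show "subspace ((\<lambda>u. X *v u) ` {u. supp u \<subseteq> J})"
      by (rule linear_subspace_image[rotated]) auto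
    show "(\<lambda>j. column j X) ` J \<subseteq> (\<lambda>u. X *v u) ` {u. supp u \<subseteq> J}"
    proof safe
      fix j assume "j \<in> J"
      then show "column j X \<in> (\<lambda>u. X *v u) ` {u. supp u \<subseteq> J}"
        by (intro image_eqI[of _ _ "axis j 1"])
          (simp add: matrix_vector_mult_basis, auto simp: supp_subset_iff axis_def)
    qed
  qed
  then show ?thesis using assms that by auto
qed

text \<open>Bounds the degrees of freedom of the noise increment from \<open>A\<close> to
  \<open>A \<union> B\<close> without any rank assumption, so that dependent columns are covered
  too.\<close>

lemma dim_colspan_Un_le:
  fixes X :: "real^'p^'n"
  shows "dim (colspan X (A \<union> B)) \<le> dim (colspan X A) + card B"
proof (induction B rule: finite_induct[OF finite])
  case (2 x F)
  have "dim (colspan X (A \<union> insert x F)) = dim (insert (column x X) ((\<lambda>j. column j X) ` (A \<union> F)))"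
    by (simp add: dim_span)
  also have "\<dots> \<le> Suc (dim ((\<lambda>j. column j X) ` (A \<union> F)))" by (simp add: dim_insert)
  finally show ?case using 2 by (simp add: dim_span)
qed auto

text \<open>A kernel vector with a nonzero coordinate \<open>j\<close> expresses column
  \<open>j\<close> through the others: subtracting a multiple of it clears coordinate
  \<open>j\<close> without changing the image. The range is then spanned by
  \<open>card J - 1\<close> columns, against the rank assumption.\<close>

lemma inj_cols_of_rank:
  fixes X :: "real^'p^'n"
  assumes "rank (submat X J) = card J" shows "inj_cols X J"
  unfolding inj_cols_def
proof (intro allI impI, rule ccontr)
  fix u assume u: "supp u \<subseteq> J" "X *v u = 0" "u \<noteq> 0"
  then obtain j where j: "u $ j \<noteq> 0" by (auto simp: vec_eq_iff)
  then have jJ: "j \<in> J" using u by (auto simp: supp_subset_iff)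
  have "range (\<lambda>x. submat X J *v x) \<subseteq> colspan X (J - {j})"
  proof safe
    fix x :: "real^'p"
    define x' where "x' = (\<chi> i. if i \<in> J then x $ i else 0)"
    define w where "w = x' - (x' $ j / u $ j) *\<^sub>R u"
    have "submat X J *v x = X *v x'"
      by (auto simp: vec_eq_iff matrix_vector_mult_def submat_def x'_def intro!: sum.cong)
    also have "\<dots> = X *v w"
      using u(2) by (simp add: w_def matrix_vector_mult_diff_distrib matrix_vector_mult_scaleR)
    also have "supp w \<subseteq> J - {j}"
      using u(1) j by (auto simp: supp_subset_iff w_def x'_def)
    then have "X *v w \<in> colspan X (J - {j})" by (rule mult_in_colspan)
    finally show "submat X J *v x \<in> colspan X (J - {j})" .
  qed
  then have "rank (submat X J) \<le> dim ((\<lambda>j. column j X) ` (J - {j}))"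
    by (metis rank_dim_range dim_span dim_subset)
  also have "\<dots> \<le> card ((\<lambda>j. column j X) ` (J - {j}))" by (rule dim_le_card') simp
  also have "\<dots> \<le> card (J - {j})" by (rule card_image_le) simp
  also have "\<dots> < card J" using jJ by (auto simp: card_gt_0_iff intro!: diff_less)
  finally show False using assms by simp
qed

section \<open>Restricted smallest singular values\<close>

lemma nu_set_bound:
  fixes X :: "real^'p^'n"
  assumes "supp u \<subseteq> J"
  shows "sqrt (real CARD('n)) * nu_set X J * norm u \<le> norm (X *v u)"
proof (cases "u = 0")
  case False
  define w where "w = (1 / norm u) *\<^sub>R u"
  have w: "supp w \<subseteq> J" "norm w = 1" using assms False by (auto simp: w_def supp_subset_iff)
  have "nu_set X J \<le> norm (submat X J *v w) / sqrt (real CARD('n))"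
    unfolding nu_set_def by (rule cINF_lower) (use w in \<open>auto intro!: bdd_belowI[of _ 0]\<close>)
  also have "submat X J *v w = (1 / norm u) *\<^sub>R (X *v u)"
    using submat_mult[OF w(1), of X] by (simp add: w_def matrix_vector_mult_scaleR)
  finally show ?thesis using False by (simp add: field_simps)
qed auto

text \<open>The infimum is attained: the unit vectors supported in \<open>J\<close> form a compact
  set, nonempty because \<open>J\<close> is, and injectivity makes the continuous objective positive
  at the minimizer.\<close>

lemma nu_set_pos:
  fixes X :: "real^'p^'n"
  assumes "J \<noteq> {}" "inj_cols X J" shows "nu_set X J > 0"
proof -
  define U where "U = {u :: real^'p. supp u \<subseteq> J \<and> norm u = 1}"
  define f where "f u = norm (submat X J *v u) / sqrt (real CARD('n))" for u
  have eq: "U = (\<Inter>j\<in>-J. {u. u $ j = 0}) \<inter> sphere 0 1" by (auto simp: U_def supp_subset_iff)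
  have "closed (\<Inter>j\<in>-J. {u :: real^'p. u $ j = 0})"
    by (intro closed_INT ballI closed_Collect_eq continuous_on_component continuous_on_const continuous_on_id)
  then have cp: "compact U" unfolding eq by (rule closed_Int_compact) auto
  obtain j where "j \<in> J" using assms by auto
  then have "axis j 1 \<in> U" unfolding U_def mem_Collect_eq norm_axis_1
    by (auto simp: supp_subset_iff axis_def)
  then have ne: "U \<noteq> {}" by blast
  have "continuous_on U f" unfolding f_def
    by (intro continuous_on_divide continuous_on_norm continuous_on_const linear_continuous_on
        matrix_vector_mul_bounded_linear) auto
  from continuous_attains_inf[OF cp ne this] obtain u where u: "u \<in> U" "\<forall>v\<in>U. f u \<le> f v" ..
  have "u \<noteq> 0" using u(1) by (auto simp: U_def)
  then have "X *v u \<noteq> 0" using u(1) assms(2) unfolding inj_cols_def U_def by blast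
  then have "0 < f u" using u(1) by (simp add: submat_mult f_def U_def)
  also have "\<dots> \<le> Inf (f ` U)" by (rule cINF_greatest[OF ne]) (use u in blast)
  finally show ?thesis by (simp add: nu_set_def f_def U_def)
qed

lemma inj_cols_of_nu_set_pos:
  fixes X :: "real^'p^'n"
  assumes "nu_set X J > 0" shows "inj_cols X J"
  unfolding inj_cols_def
proof (intro allI impI)
  fix u assume "supp u \<subseteq> J" "X *v u = 0"
  with nu_set_bound[of u J X] have "(sqrt (real CARD('n)) * nu_set X J) * norm u \<le> 0" by simp
  moreover have "sqrt (real CARD('n)) * nu_set X J > 0" using assms by simp
  ultimately show "u = 0" by (metis linorder_not_less mult_pos_pos norm_le_zero_iff)
qed

lemma cond_I_inj_cols: "cond_I X s \<Longrightarrow> real (card J) \<le> s \<Longrightarrow> inj_cols X J"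
  by (simp add: cond_I_def inj_cols_of_rank)

lemma nu_le_nu_set: "1 \<le> card J \<Longrightarrow> real (card J) \<le> s \<Longrightarrow> nu X s \<le> nu_set X J"
  unfolding nu_def by (rule Min_le) auto

lemma nu_pos:
  fixes X :: "real^'p^'n"
  assumes "cond_I X s" "1 \<le> s" shows "nu X s > 0"
proof -
  let ?F = "{J :: 'p set. 1 \<le> card J \<and> real (card J) \<le> s}"
  \<comment> \<open>The bound \<open>1 \<le> s\<close> admits singletons, so the minimum runs over a
    nonempty family; any index serves.\<close>
  have "{undefined} \<in> ?F" using assms(2) by simp
  then have "nu_set X ` ?F \<noteq> {}" by blast
  then have "nu X s \<in> nu_set X ` ?F" unfolding nu_def by (intro Min_in finite_imageI finite)
  then obtain J where "J \<in> ?F" "nu X s = nu_set X J" by blast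
  moreover from this have "J \<noteq> {}" by auto
  ultimately show ?thesis using nu_set_pos[of J X] cond_I_inj_cols[OF assms(1), of J] by auto
qed

lemma nu_min_le: "J \<noteq> {} \<Longrightarrow> nu_set X J > 0 \<Longrightarrow> nu_min X \<le> nu_set X J"
  unfolding nu_min_def by (rule Min_le) auto

lemma nu_min_pos:
  assumes "J \<noteq> {}" "nu_set X J > 0" shows "nu_min X > 0"
proof -
  have "nu_min X \<in> nu_set X ` {J. J \<noteq> {} \<and> nu_set X J > 0}"
    unfolding nu_min_def by (rule Min_in) (use assms in auto)
  then show ?thesis by auto
qed

text \<open>Pythagoras splits the squared distance from \<open>y\<close> to \<open>X *v b\<close>
  into a constant and the squared distance to the projection, and the latter can be made zero.
  Minimizers are therefore the preimages of the projection.\<close>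

lemma least_squares_iff:
  fixes X :: "real^'p^'n"
  shows "least_squares X J y b \<longleftrightarrow> supp b \<subseteq> J \<and> X *v b = orth_proj (colspan X J) y"
proof -
  let ?P = "orth_proj (colspan X J) y"
  have py: "(norm (y - submat X J *v b))\<^sup>2 = (norm (y - ?P))\<^sup>2 + (norm (?P - X *v b))\<^sup>2"
    if "supp b \<subseteq> J" for b
    using orth_proj_dist_pythagoras[OF subspace_span mult_in_colspan[OF that]] submat_mult[OF that]
    by metis
  obtain b0 where b0: "supp b0 \<subseteq> J" "?P = X *v b0"
    by (rule colspanE[OF orth_proj_mem[OF subspace_span]])
  have min: "(norm (y - ?P))\<^sup>2 \<le> (norm (y - submat X J *v b))\<^sup>2" if "supp b \<subseteq> J" for b
    using py[OF that] by simp
  show ?thesis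
  proof
    assume "least_squares X J y b"
    then have b: "supp b \<subseteq> J" "\<not> norm (y - submat X J *v b0) < norm (y - submat X J *v b)"
      using b0 by (auto simp: least_squares_def is_arg_min_def)
    then have "(norm (y - submat X J *v b))\<^sup>2 \<le> (norm (y - submat X J *v b0))\<^sup>2"
      by (intro power_mono) auto
    then show "supp b \<subseteq> J \<and> X *v b = ?P" using py[OF b(1)] py[OF b0(1)] b0 b by simp
  next
    assume b: "supp b \<subseteq> J \<and> X *v b = ?P"
    then have "norm (y - submat X J *v b) \<le> norm (y - submat X J *v b')" if "supp b' \<subseteq> J" for b'
      using min[OF that] by (simp add: submat_mult)
    then show "least_squares X J y b" using b
      by (force simp: least_squares_def is_arg_min_def not_less)
  qed
qed

lemma inj_cols_unique:
  assumes "inj_cols X J" "supp a \<subseteq> J" "supp b \<subseteq> J" "X *v a = X *v b" shows "a = b"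
proof -
  have "supp (a - b) \<subseteq> J" using supp_diff_subset[of a b] assms by auto
  then show ?thesis using assms unfolding inj_cols_def
    by (metis matrix_vector_mult_diff_distrib right_minus_eq)
qed

text \<open>With independent columns the projection has only one preimage supported in
  \<open>J\<close>, so the minimum-norm selection in \<open>beta_hat\<close> chooses from a
  singleton.\<close>

lemma
  fixes X :: "real^'p^'n"
  assumes "inj_cols X J"
  shows supp_beta_hat: "supp (beta_hat X J y) \<subseteq> J"
    and mult_beta_hat: "X *v beta_hat X J y = orth_proj (colspan X J) y"
proof -
  obtain b0 where b0: "supp b0 \<subseteq> J" "orth_proj (colspan X J) y = X *v b0"
    by (rule colspanE[OF orth_proj_mem[OF subspace_span]])
  have "least_squares X J y b \<longleftrightarrow> b = b0" for b
    using inj_cols_unique[OF assms] b0 unfolding least_squares_iff by metis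
  then have "beta_hat X J y = b0"
    by (auto simp: beta_hat_def is_arg_min_def)
  then show "supp (beta_hat X J y) \<subseteq> J" "X *v beta_hat X J y = orth_proj (colspan X J) y"
    using b0 by auto
qed

lemma linear_beta_hat:
  fixes X :: "real^'p^'n"
  assumes "inj_cols X J" shows "linear (beta_hat X J)"
proof -
  note P = linear_orth_proj[OF subspace_span[of "(\<lambda>j. column j X) ` J"]]
  note b = supp_beta_hat[OF assms] mult_beta_hat[OF assms]
  have sup: "beta_hat X J y $ j = 0" if "j \<notin> J" for y j
    using b(1)[of y] that by (auto simp: supp_subset_iff)
  show ?thesis
  proof (rule linearI)
    fix x y :: "real^'n" and r :: real
    show "beta_hat X J (x + y) = beta_hat X J x + beta_hat X J y"
      by (rule inj_cols_unique[OF assms b(1)])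
        (auto simp: supp_subset_iff sup b(2) matrix_vector_right_distrib linear_add[OF P])
    show "beta_hat X J (r *\<^sub>R x) = r *\<^sub>R beta_hat X J x"
      by (rule inj_cols_unique[OF assms b(1)])
        (auto simp: supp_subset_iff sup b(2) matrix_vector_mult_scaleR linear_scale[OF P])
  qed
qed

lemma beta_hat_empty: "beta_hat X {} y = 0"
proof -
  have "inj_cols X {}" by (auto simp: inj_cols_def supp_def vec_eq_iff)
  from supp_beta_hat[OF this, of y] show ?thesis by (auto simp: supp_def vec_eq_iff)
qed

lemma linear_resid: "linear (resid X J)"
  unfolding resid_def
  by (intro linear_compose_sub linear_id[unfolded id_def] linear_orth_proj subspace_span)

section \<open>Gaussian concentration\<close>

text \<open>Completing the square: the tilt moves the mean to \<open>\<sigma>\<^sup>2 * a\<close>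
  and keeps the variance.\<close>

lemma normal_density_mult_exp:
  assumes "\<sigma> > 0"
  shows "normal_density 0 \<sigma> x * exp (a * x) = exp (\<sigma>\<^sup>2 * a\<^sup>2 / 2) * normal_density (\<sigma>\<^sup>2 * a) \<sigma> x"
proof -
  have "- (x - 0)\<^sup>2 / (2 * \<sigma>\<^sup>2) + a * x = \<sigma>\<^sup>2 * a\<^sup>2 / 2 + - (x - \<sigma>\<^sup>2 * a)\<^sup>2 / (2 * \<sigma>\<^sup>2)"
    using assms by (simp add: field_simps power2_eq_square)
  then show ?thesis
    unfolding normal_density_def by (simp add: mult.commute mult.left_commute flip: exp_add)
qed

text \<open>The quadratic part \<open>- x\<^sup>2 / 2 + 3 / 8 * x\<^sup>2 = - x\<^sup>2 / 8\<close>
  belongs to standard deviation 2, and the change of normalization is the factor 2.\<close>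

lemma normal_density_mult_exp_square:
  "normal_density 0 1 x * exp (a * x + 3 / 8 * x\<^sup>2) = 2 * exp (2 * a\<^sup>2) * normal_density (4 * a) 2 x"
proof -
  have "- (x - 0)\<^sup>2 / (2 * 1\<^sup>2) + (a * x + 3 / 8 * x\<^sup>2) = 2 * a\<^sup>2 + - (x - 4 * a)\<^sup>2 / (2 * 2\<^sup>2)"
    by (simp add: field_simps power2_eq_square)
  moreover have "sqrt (2 * pi * 2\<^sup>2) = 2 * sqrt (2 * pi)"
    by (subst mult.commute, subst real_sqrt_mult) simp
  ultimately show ?thesis
    unfolding normal_density_def by (simp add: mult.commute mult.left_commute flip: exp_add)
qed

lemma nn_integral_normal_density:
  "\<sigma> > 0 \<Longrightarrow> (\<integral>\<^sup>+x. ennreal (normal_density \<mu> \<sigma> x) \<partial>lborel) = 1"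
  by (subst nn_integral_eq_integral) (auto intro: integrable_normal_density)

lemma nn_integral_normal_density_mult_exp:
  assumes "\<sigma> > 0"
  shows "(\<integral>\<^sup>+x. ennreal (normal_density 0 \<sigma> x) * ennreal (exp (a * x)) \<partial>lborel)
    = ennreal (exp (\<sigma>\<^sup>2 * a\<^sup>2 / 2))"
proof -
  have "(\<integral>\<^sup>+x. ennreal (normal_density 0 \<sigma> x) * ennreal (exp (a * x)) \<partial>lborel)
    = (\<integral>\<^sup>+x. ennreal (exp (\<sigma>\<^sup>2 * a\<^sup>2 / 2)) * ennreal (normal_density (\<sigma>\<^sup>2 * a) \<sigma> x) \<partial>lborel)"
    by (simp add: normal_density_mult_exp[OF assms] flip: ennreal_mult)
  then show ?thesis by (simp add: nn_integral_cmult nn_integral_normal_density[OF assms])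
qed

lemma nn_integral_normal_density_mult_exp_square:
  "(\<integral>\<^sup>+x. ennreal (normal_density 0 1 x) * ennreal (exp (a * x + 3 / 8 * x\<^sup>2)) \<partial>lborel)
    = ennreal (2 * exp (2 * a\<^sup>2))"
proof -
  have "(\<integral>\<^sup>+x. ennreal (normal_density 0 1 x) * ennreal (exp (a * x + 3 / 8 * x\<^sup>2)) \<partial>lborel)
    = (\<integral>\<^sup>+x. ennreal (2 * exp (2 * a\<^sup>2)) * ennreal (normal_density (4 * a) 2 x) \<partial>lborel)"
    by (simp only: ennreal_mult[symmetric] normal_density_nonneg exp_ge_zero mult_nonneg_nonneg
        zero_le_numeral normal_density_mult_exp_square)
  then show ?thesis by (simp add: nn_integral_cmult nn_integral_normal_density)
qed

context prob_space
begin

lemma isotropic_gaussian_measurable [measurable]: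
  assumes "isotropic_gaussian M z \<sigma>" shows "z \<in> borel_measurable M"
proof -
  have "(\<lambda>\<omega>. z \<omega> $ i) \<in> borel_measurable M" for i
    using assms by (auto simp: isotropic_gaussian_def distributed_def)
  then have "(\<lambda>\<omega>. z \<omega> \<bullet> b) \<in> borel_measurable M" if "b \<in> Basis" for b
    using that by (auto simp: Basis_vec_def inner_axis)
  then show ?thesis using borel_measurable_euclidean_space by blast
qed

lemma isotropic_gaussian_mgf:
  fixes z :: "'a \<Rightarrow> real^'n"
  assumes z: "isotropic_gaussian M z \<sigma>" and \<sigma>: "\<sigma> > 0"
  shows "(\<integral>\<^sup>+\<omega>. ennreal (exp (v \<bullet> z \<omega>)) \<partial>M) = ennreal (exp (\<sigma>\<^sup>2 * (norm v)\<^sup>2 / 2))"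
proof -
  have ind: "indep_vars (\<lambda>_. borel) (\<lambda>i \<omega>. z \<omega> $ i) UNIV"
    and d: "distributed M lborel (\<lambda>\<omega>. z \<omega> $ i) (\<lambda>x. ennreal (normal_density 0 \<sigma> x))" for i
    using z by (auto simp: isotropic_gaussian_def)
  have "(\<integral>\<^sup>+\<omega>. ennreal (exp (v \<bullet> z \<omega>)) \<partial>M) = (\<integral>\<^sup>+\<omega>. (\<Prod>i\<in>UNIV. ennreal (exp (v $ i * z \<omega> $ i))) \<partial>M)"
    by (simp add: inner_vec_def exp_sum prod_ennreal)
  also have "\<dots> = (\<Prod>i\<in>UNIV. \<integral>\<^sup>+\<omega>. ennreal (exp (v $ i * z \<omega> $ i)) \<partial>M)"
    by (intro indep_vars_nn_integral indep_vars_compose2[OF ind, of "\<lambda>i x. ennreal (exp (v $ i * x))"]) auto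
  also have "\<dots> = (\<Prod>i\<in>UNIV. ennreal (exp (\<sigma>\<^sup>2 * (v $ i)\<^sup>2 / 2)))"
    by (intro prod.cong refl)
      (simp add: distributed_nn_integral[OF d, of "\<lambda>x. ennreal (exp (v $ i * x))" for i, symmetric] nn_integral_normal_density_mult_exp[OF \<sigma>])
  also have "\<dots> = ennreal (exp (\<sigma>\<^sup>2 * (norm v)\<^sup>2 / 2))"
  proof -
    have "(norm v)\<^sup>2 = (\<Sum>i\<in>UNIV. (v $ i)\<^sup>2)"
      by (simp only: power2_norm_eq_inner inner_vec_def) (simp add: power2_eq_square)
    then show ?thesis
      by (simp add: prod_ennreal sum_distrib_left sum_divide_distrib flip: exp_sum)
  qed
  finally show ?thesis .
qed

text \<open>A Gaussian square is decoupled as \<open>exp (3/8 w\<^sup>2) = E exp (sqrt 3 / 2 g w)\<close> with an auxiliary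
  standard normal \<open>g\<close>; this avoids the rotation invariance of the distribution of \<open>z\<close>.\<close>
lemma isotropic_gaussian_mgf_quadratic:
  fixes z :: "'a \<Rightarrow> real^'n"
  assumes z: "isotropic_gaussian M z \<sigma>" and \<sigma>: "\<sigma> > 0"
    and B: "finite B" "pairwise orthogonal B" "\<And>b. b \<in> B \<Longrightarrow> norm b = 1"
  shows "(\<integral>\<^sup>+\<omega>. ennreal (exp (v \<bullet> z \<omega> + 3 / 8 * (\<Sum>b\<in>B. (b \<bullet> z \<omega>)\<^sup>2) / \<sigma>\<^sup>2)) \<partial>M)
    \<le> ennreal (2 ^ card B * exp (\<sigma>\<^sup>2 * (norm v)\<^sup>2 / 2 + 3 / 2 * \<sigma>\<^sup>2 * (\<Sum>b\<in>B. (b \<bullet> v)\<^sup>2)))"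
  using B
\<comment> \<open>Decoupling one square replaces \<open>v\<close> by
  \<open>v + (\<kappa> * g) *\<^sub>R b\<close>, hence the generalization over \<open>v\<close>; by
  orthogonality the coefficients of \<open>v\<close> along the remaining vectors stay the
  same.\<close>
proof (induction B arbitrary: v rule: finite_induct)
  case empty
  then show ?case by (simp add: isotropic_gaussian_mgf[OF z \<sigma>])
next
  case (insert b B)
  note [measurable] = isotropic_gaussian_measurable[OF z]
  \<comment> \<open>Chosen so that \<open>\<kappa>\<^sup>2 / 2 = 3 / (8 * \<sigma>\<^sup>2)\<close>:
    the moment generating function of \<open>g\<close> at
    \<open>\<kappa> * (b \<bullet> z \<omega>)\<close> is then the exponential of the square being
    added.\<close>
  define \<kappa> where "\<kappa> = sqrt 3 / (2 * \<sigma>)"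
  have \<kappa>2: "\<kappa>\<^sup>2 * \<sigma>\<^sup>2 = 3 / 4" using \<sigma> by (simp add: \<kappa>_def power_divide power_mult_distrib)
  have nb: "norm b = 1" using insert by simp
  have po: "pairwise orthogonal B" "\<And>b'. b' \<in> B \<Longrightarrow> norm b' = 1"
    using insert by (auto simp: pairwise_insert)
  have ob: "b' \<bullet> b = 0" if "b' \<in> B" for b'
    using insert.prems(1) insert.hyps that by (auto simp: pairwise_insert orthogonal_def)
  define Q where "Q \<omega> = 3 / 8 * (\<Sum>b\<in>B. (b \<bullet> z \<omega>)\<^sup>2) / \<sigma>\<^sup>2" for \<omega>
  define K where "K = 2 ^ card B * exp (\<sigma>\<^sup>2 * (norm v)\<^sup>2 / 2 + 3 / 2 * \<sigma>\<^sup>2 * (\<Sum>b\<in>B. (b \<bullet> v)\<^sup>2))"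
  define a where "a = \<sigma>\<^sup>2 * \<kappa> * (b \<bullet> v)"
  have [measurable]: "Q \<in> borel_measurable M" unfolding Q_def by measurable
  interpret pair_sigma_finite M lborel ..
  have decouple: "ennreal (exp (v \<bullet> z \<omega> + 3 / 8 * (\<Sum>b\<in>insert b B. (b \<bullet> z \<omega>)\<^sup>2) / \<sigma>\<^sup>2))
    = (\<integral>\<^sup>+g. ennreal (normal_density 0 1 g) * ennreal (exp ((v + (\<kappa> * g) *\<^sub>R b) \<bullet> z \<omega> + Q \<omega>)) \<partial>lborel)" for \<omega>
  proof -
    have "\<kappa>\<^sup>2 * (b \<bullet> z \<omega>)\<^sup>2 / 2 = 3 / 8 * (b \<bullet> z \<omega>)\<^sup>2 / \<sigma>\<^sup>2"
      using \<kappa>2 \<sigma> by (simp add: field_simps)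
    then have "v \<bullet> z \<omega> + 3 / 8 * (\<Sum>b\<in>insert b B. (b \<bullet> z \<omega>)\<^sup>2) / \<sigma>\<^sup>2
      = (v \<bullet> z \<omega> + Q \<omega>) + 1\<^sup>2 * (\<kappa> * (b \<bullet> z \<omega>))\<^sup>2 / 2"
      using insert.hyps by (simp add: Q_def add_divide_distrib power_mult_distrib algebra_simps)
    then have "ennreal (exp (v \<bullet> z \<omega> + 3 / 8 * (\<Sum>b\<in>insert b B. (b \<bullet> z \<omega>)\<^sup>2) / \<sigma>\<^sup>2))
      = ennreal (exp (v \<bullet> z \<omega> + Q \<omega>)) * ennreal (exp (1\<^sup>2 * (\<kappa> * (b \<bullet> z \<omega>))\<^sup>2 / 2))"
      by (simp only: exp_add[of "v \<bullet> z \<omega> + Q \<omega>"] ennreal_mult' exp_ge_zero)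
    also have "\<dots> = (\<integral>\<^sup>+g. ennreal (exp (v \<bullet> z \<omega> + Q \<omega>)) *
        (ennreal (normal_density 0 1 g) * ennreal (exp (\<kappa> * (b \<bullet> z \<omega>) * g))) \<partial>lborel)"
      unfolding nn_integral_normal_density_mult_exp[OF zero_less_one, symmetric]
      by (subst nn_integral_cmult) auto
    also have "\<dots> = (\<integral>\<^sup>+g. ennreal (normal_density 0 1 g) *
        ennreal (exp ((v + (\<kappa> * g) *\<^sub>R b) \<bullet> z \<omega> + Q \<omega>)) \<partial>lborel)"
      by (intro nn_integral_cong)
        (simp add: inner_add_left algebra_simps exp_add flip: ennreal_mult)
    finally show ?thesis .
  qed
  have "(\<integral>\<^sup>+\<omega>. ennreal (exp (v \<bullet> z \<omega> + 3 / 8 * (\<Sum>b\<in>insert b B. (b \<bullet> z \<omega>)\<^sup>2) / \<sigma>\<^sup>2)) \<partial>M)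
    = (\<integral>\<^sup>+g. (\<integral>\<^sup>+\<omega>. ennreal (normal_density 0 1 g) *
        ennreal (exp ((v + (\<kappa> * g) *\<^sub>R b) \<bullet> z \<omega> + Q \<omega>)) \<partial>M) \<partial>lborel)"
    unfolding decouple by (rule Fubini'[symmetric]) measurable
  also have "\<dots> = (\<integral>\<^sup>+g. ennreal (normal_density 0 1 g) * (\<integral>\<^sup>+\<omega>.
        ennreal (exp ((v + (\<kappa> * g) *\<^sub>R b) \<bullet> z \<omega> + Q \<omega>)) \<partial>M) \<partial>lborel)"
    by (intro nn_integral_cong nn_integral_cmult) measurable
  also have "\<dots> \<le> (\<integral>\<^sup>+g. ennreal (normal_density 0 1 g) *
      ennreal (K * exp (a * g + 3 / 8 * g\<^sup>2)) \<partial>lborel)"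
  proof (intro nn_integral_mono mult_left_mono zero_le)
    fix g :: real
    have n: "(norm (v + (\<kappa> * g) *\<^sub>R b))\<^sup>2 = (norm v)\<^sup>2 + 2 * \<kappa> * g * (b \<bullet> v) + \<kappa>\<^sup>2 * g\<^sup>2"
      using nb unfolding power2_norm_eq_inner norm_eq_1
      by (simp add: inner_add_left inner_add_right inner_commute power2_eq_square algebra_simps)
    \<comment> \<open>Averaging over the noise leaves a square in \<open>g\<close> with coefficient
      \<open>\<kappa>\<^sup>2 * \<sigma>\<^sup>2 / 2 = 3 / 8\<close>, the one for which the integral
      over \<open>g\<close> is known.\<close>
    have "\<sigma>\<^sup>2 * (norm (v + (\<kappa> * g) *\<^sub>R b))\<^sup>2 / 2
      = \<sigma>\<^sup>2 * (norm v)\<^sup>2 / 2 + a * g + (\<kappa>\<^sup>2 * \<sigma>\<^sup>2) * g\<^sup>2 / 2"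
      unfolding n a_def by (simp add: algebra_simps add_divide_distrib)
    then have e: "\<sigma>\<^sup>2 * (norm (v + (\<kappa> * g) *\<^sub>R b))\<^sup>2 / 2
      = \<sigma>\<^sup>2 * (norm v)\<^sup>2 / 2 + (a * g + 3 / 8 * g\<^sup>2)" unfolding \<kappa>2 by simp
    have s: "(\<Sum>b'\<in>B. (b' \<bullet> (v + (\<kappa> * g) *\<^sub>R b))\<^sup>2) = (\<Sum>b\<in>B. (b \<bullet> v)\<^sup>2)"
      by (intro sum.cong refl) (simp add: inner_add_right ob)
    show "(\<integral>\<^sup>+\<omega>. ennreal (exp ((v + (\<kappa> * g) *\<^sub>R b) \<bullet> z \<omega> + Q \<omega>)) \<partial>M)
      \<le> ennreal (K * exp (a * g + 3 / 8 * g\<^sup>2))"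
      using insert.IH[OF po, of "v + (\<kappa> * g) *\<^sub>R b"] unfolding e s K_def Q_def
      by (simp add: exp_add algebra_simps)
  qed
  also have "\<dots> = (\<integral>\<^sup>+g. ennreal K * (ennreal (normal_density 0 1 g) *
      ennreal (exp (a * g + 3 / 8 * g\<^sup>2))) \<partial>lborel)"
    by (intro nn_integral_cong) (simp add: K_def algebra_simps flip: ennreal_mult)
  also have "\<dots> = ennreal K * ennreal (2 * exp (2 * a\<^sup>2))"
    unfolding nn_integral_normal_density_mult_exp_square[symmetric]
    by (rule nn_integral_cmult) measurable
  also have "\<dots> = ennreal (2 ^ card (insert b B) *
      exp (\<sigma>\<^sup>2 * (norm v)\<^sup>2 / 2 + 3 / 2 * \<sigma>\<^sup>2 * (\<Sum>b\<in>insert b B. (b \<bullet> v)\<^sup>2)))"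
  proof -
    have "a\<^sup>2 = (\<kappa>\<^sup>2 * \<sigma>\<^sup>2) * \<sigma>\<^sup>2 * (b \<bullet> v)\<^sup>2" by (simp add: a_def power2_eq_square)
    then have "2 * a\<^sup>2 = 3 / 2 * \<sigma>\<^sup>2 * (b \<bullet> v)\<^sup>2" unfolding \<kappa>2 by simp
    then show ?thesis using insert.hyps unfolding K_def
      by (simp add: exp_add algebra_simps flip: ennreal_mult)
  qed
  finally show ?case .
qed

text \<open>Markov's inequality for the exponential, stated with nonnegative integrals so that
  finiteness comes from the bound itself.\<close>

lemma chernoff_bound:
  assumes f [measurable]: "f \<in> borel_measurable M" and K: "0 \<le> K"
    and "(\<integral>\<^sup>+\<omega>. ennreal (exp (f \<omega>)) \<partial>M) \<le> ennreal K"
  shows "prob {\<omega> \<in> space M. f \<omega> > x} \<le> K * exp (- x)"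
proof -
  have "emeasure M {\<omega> \<in> space M. f \<omega> > x}
    \<le> emeasure M {\<omega> \<in> space M. 1 \<le> ennreal (exp (- x)) * ennreal (exp (f \<omega>))}"
    by (rule emeasure_mono) (auto simp flip: ennreal_mult exp_add)
  also have "\<dots> \<le> ennreal (exp (- x)) * (\<integral>\<^sup>+\<omega>. ennreal (exp (f \<omega>)) * indicator (space M) \<omega> \<partial>M)"
    by (rule nn_integral_Markov_inequality) auto
  also have "(\<integral>\<^sup>+\<omega>. ennreal (exp (f \<omega>)) * indicator (space M) \<omega> \<partial>M) = (\<integral>\<^sup>+\<omega>. ennreal (exp (f \<omega>)) \<partial>M)"
    by (rule nn_integral_cong) auto
  also have "ennreal (exp (- x)) * \<dots> \<le> ennreal (exp (- x)) * ennreal K"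
    by (intro mult_left_mono assms) auto
  also have "\<dots> = ennreal (K * exp (- x))" using K by (simp add: mult.commute flip: ennreal_mult)
  finally show ?thesis using K by (simp add: emeasure_eq_measure)
qed

lemma isotropic_gaussian_tail:
  fixes z :: "'a \<Rightarrow> real^'n"
  assumes z: "isotropic_gaussian M z \<sigma>" and \<sigma>: "\<sigma> > 0" and x: "x \<ge> 0"
  shows "prob {\<omega> \<in> space M. v \<bullet> z \<omega> > \<sigma> * norm v * x} \<le> exp (- x\<^sup>2 / 2)"
proof (cases "v = 0")
  case False
  note [measurable] = isotropic_gaussian_measurable[OF z]
  \<comment> \<open>The minimizer of \<open>\<sigma>\<^sup>2 * k\<^sup>2 * (norm v)\<^sup>2 / 2 - k
    * \<sigma> * norm v * x\<close>; after scaling by it the threshold is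
    \<open>x\<^sup>2\<close>.\<close>
  define k where "k = x / (\<sigma> * norm v)"
  show ?thesis
  proof (cases "x = 0")
    case False
    then have k: "k > 0" using \<open>v \<noteq> 0\<close> \<sigma> x by (simp add: k_def)
    have "prob {\<omega> \<in> space M. (k *\<^sub>R v) \<bullet> z \<omega> > x\<^sup>2}
      \<le> exp (\<sigma>\<^sup>2 * (norm (k *\<^sub>R v))\<^sup>2 / 2) * exp (- x\<^sup>2)"
      by (rule chernoff_bound) (auto simp: isotropic_gaussian_mgf[OF z \<sigma>, of "k *\<^sub>R v", simplified])
    also have "\<sigma>\<^sup>2 * (norm (k *\<^sub>R v))\<^sup>2 = x\<^sup>2"
      using \<open>v \<noteq> 0\<close> \<sigma> by (simp add: k_def power_mult_distrib power_divide)
    also have "exp (x\<^sup>2 / 2) * exp (- x\<^sup>2) = exp (- x\<^sup>2 / 2)" by (simp flip: exp_add)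
    also have "{\<omega> \<in> space M. (k *\<^sub>R v) \<bullet> z \<omega> > x\<^sup>2} = {\<omega> \<in> space M. v \<bullet> z \<omega> > \<sigma> * norm v * x}"
    proof -
      have "x\<^sup>2 = k * (\<sigma> * norm v * x)"
        using \<open>v \<noteq> 0\<close> \<sigma> by (simp add: k_def power2_eq_square)
      then show ?thesis using k by auto
    qed
    finally show ?thesis .
  qed auto
qed auto

lemma isotropic_gaussian_tail_abs:
  fixes z :: "'a \<Rightarrow> real^'n"
  assumes z: "isotropic_gaussian M z \<sigma>" and \<sigma>: "\<sigma> > 0" and x: "x \<ge> 0"
  shows "prob {\<omega> \<in> space M. \<bar>v \<bullet> z \<omega>\<bar> > \<sigma> * norm v * x} \<le> 2 * exp (- x\<^sup>2 / 2)"
proof -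
  note [measurable] = isotropic_gaussian_measurable[OF z]
  have "{\<omega> \<in> space M. \<bar>v \<bullet> z \<omega>\<bar> > \<sigma> * norm v * x} \<subseteq>
    {\<omega> \<in> space M. v \<bullet> z \<omega> > \<sigma> * norm v * x} \<union> {\<omega> \<in> space M. (- v) \<bullet> z \<omega> > \<sigma> * norm (- v) * x}"
    by auto
  then have "prob {\<omega> \<in> space M. \<bar>v \<bullet> z \<omega>\<bar> > \<sigma> * norm v * x} \<le>
    prob ({\<omega> \<in> space M. v \<bullet> z \<omega> > \<sigma> * norm v * x} \<union> {\<omega> \<in> space M. (- v) \<bullet> z \<omega> > \<sigma> * norm (- v) * x})"
    by (intro finite_measure_mono) measurable
  also have "\<dots> \<le> prob {\<omega> \<in> space M. v \<bullet> z \<omega> > \<sigma> * norm v * x}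
      + prob {\<omega> \<in> space M. (- v) \<bullet> z \<omega> > \<sigma> * norm (- v) * x}"
    by (rule measure_Un_le) measurable
  also have "\<dots> \<le> exp (- x\<^sup>2 / 2) + exp (- x\<^sup>2 / 2)"
    by (intro add_mono isotropic_gaussian_tail[OF z \<sigma> x])
  finally show ?thesis by simp
qed

text \<open>The quadratic moment bound with zero linear term: the increment has at most
  \<open>r\<close> dimensions, and each costs a factor 2.\<close>

lemma orth_proj_increment_tail:
  fixes z :: "'a \<Rightarrow> real^'n"
  assumes z: "isotropic_gaussian M z \<sigma>" and \<sigma>: "\<sigma> > 0"
    and ST: "subspace S" "subspace T" "S \<subseteq> T" "dim T \<le> dim S + r"
  shows "prob {\<omega> \<in> space M. (norm (orth_proj T (z \<omega>)))\<^sup>2 - (norm (orth_proj S (z \<omega>)))\<^sup>2 > \<sigma>\<^sup>2 * x}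
    \<le> 2 ^ r * exp (- 3 / 8 * x)"
proof -
  note [measurable] = isotropic_gaussian_measurable[OF z]
  obtain B where B: "finite B" "pairwise orthogonal B" "\<And>b. b \<in> B \<Longrightarrow> norm b = 1"
    "card B + dim S = dim T"
    "\<And>v. (norm (orth_proj T v))\<^sup>2 - (norm (orth_proj S v))\<^sup>2 = (\<Sum>b\<in>B. (b \<bullet> v)\<^sup>2)"
    using orth_proj_increment[OF ST(1-3)] by metis
  have "prob {\<omega> \<in> space M. 0 \<bullet> z \<omega> + 3 / 8 * (\<Sum>b\<in>B. (b \<bullet> z \<omega>)\<^sup>2) / \<sigma>\<^sup>2 > 3 / 8 * x}
    \<le> 2 ^ card B * exp (\<sigma>\<^sup>2 * (norm (0::real^'n))\<^sup>2 / 2 + 3 / 2 * \<sigma>\<^sup>2 * (\<Sum>b\<in>B. (b \<bullet> 0)\<^sup>2)) * exp (- (3 / 8 * x))"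
    by (rule chernoff_bound[OF _ _ isotropic_gaussian_mgf_quadratic[OF z \<sigma> B(1-3)]]) auto
  also have "\<dots> \<le> 2 ^ r * exp (- 3 / 8 * x)" using B(4) ST(4) by simp
  also have "{\<omega> \<in> space M. 0 \<bullet> z \<omega> + 3 / 8 * (\<Sum>b\<in>B. (b \<bullet> z \<omega>)\<^sup>2) / \<sigma>\<^sup>2 > 3 / 8 * x}
    = {\<omega> \<in> space M. (norm (orth_proj T (z \<omega>)))\<^sup>2 - (norm (orth_proj S (z \<omega>)))\<^sup>2 > \<sigma>\<^sup>2 * x}"
    using \<sigma> by (auto simp: B(5) field_simps)
  finally show ?thesis .
qed

end

section \<open>Sums over supports, weighted by size or distance\<close>

lemma sum_power_card_nonempty_le:
  fixes x :: real
  assumes "0 \<le> x" "real CARD('p::finite) * x \<le> 1"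
  shows "(\<Sum>D\<in>UNIV - {{} :: 'p set}. x ^ card D) \<le> 2 * real CARD('p) * x"
proof -
  \<comment> \<open>The subsets are the terms of the expanded product, so
    \<open>exp a \<le> 1 + a + a\<^sup>2\<close> for \<open>a = p * x \<le> 1\<close> replaces a
    count of subsets by size.\<close>
  have "(1 + x) ^ CARD('p) = (\<Prod>j\<in>(UNIV :: 'p set). x + 1)" by (simp add: add.commute)
  also have "\<dots> = (\<Sum>D\<in>(UNIV :: 'p set set). x ^ card D)" by (subst prod_add) auto
  also have "\<dots> = 1 + (\<Sum>D\<in>UNIV - {{} :: 'p set}. x ^ card D)"
    by (subst sum.remove[of _ "{}"]) auto
  finally have "1 + (\<Sum>D\<in>UNIV - {{} :: 'p set}. x ^ card D) = (1 + x) ^ CARD('p)" by simp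
  also have "\<dots> \<le> exp x ^ CARD('p)" using assms(1) by (intro power_mono) auto
  also have "\<dots> = exp (real CARD('p) * x)" by (simp flip: exp_of_nat_mult)
  also have "\<dots> \<le> 1 + real CARD('p) * x + (real CARD('p) * x)\<^sup>2" using assms by (intro exp_bound) auto
  also have "\<dots> \<le> 1 + 2 * real CARD('p) * x"
    using mult_left_le[OF assms(2), of "real CARD('p) * x"] assms by (simp add: power2_eq_square)
  finally show ?thesis by simp
qed

text \<open>Symmetric difference with \<open>S\<close> is an involution that carries the supports
  other than \<open>S\<close> to the nonempty sets.\<close>

lemma sum_power_card_sym_diff_le:
  fixes x :: real and S :: "'p::finite set"
  assumes "0 \<le> x" "real CARD('p) * x \<le> 1"
  shows "(\<Sum>J\<in>UNIV - {S}. x ^ card (sym_diff J S)) \<le> 2 * real CARD('p) * x"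
proof -
  have inv: "sym_diff (sym_diff D S) S = D" for D by auto
  have "sym_diff J S = {} \<longleftrightarrow> J = S" for J by auto
  moreover have "sym_diff D S = S \<longleftrightarrow> D = {}" for D by (metis Diff_cancel Un_empty_right inv Diff_empty Un_empty_left empty_Diff)
  ultimately have "(\<Sum>J\<in>UNIV - {S}. x ^ card (sym_diff J S)) = (\<Sum>D\<in>UNIV - {{} :: 'p set}. x ^ card D)"
    by (intro sum.reindex_bij_witness[of _ "\<lambda>D. sym_diff D S" "\<lambda>J. sym_diff J S"])
      (simp_all only: inv DiffD2 Diff_iff UNIV_I singleton_iff simp_thms)
  then show ?thesis using sum_power_card_nonempty_le[OF assms] by simp
qed

lemma (in prob_space) prob_UN_le:
  assumes "finite I" "\<And>i. i \<in> I \<Longrightarrow> A i \<in> events" "\<And>i. i \<in> I \<Longrightarrow> prob (A i) \<le> f i" "(\<Sum>i\<in>I. f i) \<le> K"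
  shows "(\<Union>i\<in>I. A i) \<in> events \<and> prob (\<Union>i\<in>I. A i) \<le> K"
proof
  show "(\<Union>i\<in>I. A i) \<in> events" using assms by (intro sets.finite_UN)
  have "prob (\<Union>i\<in>I. A i) \<le> (\<Sum>i\<in>I. prob (A i))"
    by (rule measure_UNION_le) (use assms in auto)
  also have "\<dots> \<le> (\<Sum>i\<in>I. f i)" by (intro sum_mono assms)
  finally show "prob (\<Union>i\<in>I. A i) \<le> K" using assms by simp
qed

text \<open>A coordinate of the estimator is a linear functional of the data. Evaluating it at its
  own representing vector \<open>w\<close> gives
  \<open>(norm w)\<^sup>2 \<le> norm (beta_hat X J w)\<close>, and the singular value bound turns
  this into a bound on \<open>norm w\<close> without an explicit inverse of the Gram matrix.\<close>

lemma inner_eq_coord_beta_hat: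
  fixes X :: "real^'p^'n"
  assumes "nu_set X J > 0"
  obtains w where "\<And>z. beta_hat X J z $ j = w \<bullet> z" "norm w \<le> 1 / (sqrt (real CARD('n)) * nu_set X J)"
proof -
  let ?N = "sqrt (real CARD('n)) * nu_set X J"
  have inj: "inj_cols X J" using assms by (rule inj_cols_of_nu_set_pos)
  have N: "?N > 0" using assms by simp
  have lin: "linear (\<lambda>z. beta_hat X J z $ j)"
    using linear_beta_hat[OF inj] by (auto simp: linear_iff)
  define w where "w = adjoint (\<lambda>z. beta_hat X J z $ j) 1"
  have w: "beta_hat X J z $ j = w \<bullet> z" for z
    using adjoint_works[OF lin, of z 1] by (simp add: w_def inner_commute)
  have "norm w * norm w = beta_hat X J w $ j" unfolding w by (metis power2_eq_square power2_norm_eq_inner)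
  also have "\<dots> \<le> norm (beta_hat X J w)" using component_le_norm_cart[of "beta_hat X J w" j] by simp
  also have "\<dots> \<le> norm w / ?N"
  proof -
    have "?N * norm (beta_hat X J w) \<le> norm (orth_proj (colspan X J) w)"
      using nu_set_bound[OF supp_beta_hat[OF inj, of w], of X] mult_beta_hat[OF inj, of w] by simp
    also have "\<dots> \<le> norm w" by (intro norm_orth_proj_le subspace_span)
    finally show ?thesis using N by (simp add: field_simps)
  qed
  finally have "norm w \<le> 1 / ?N" by (cases "w = 0") (use N in \<open>auto simp: field_simps\<close>)
  then show ?thesis using w that by blast
qed

text \<open>The failure budget \<open>4 * p powr (- c)\<close> is split as 2 for the coordinates,
  1/2 for the functionals \<open>w J\<close>, 1/2 for the increments and 1 for the projection onto
  \<open>S\<close>. The family \<open>w\<close> does not depend on the noise, so the Gaussian tail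
  applies to each member.\<close>

lemma (in prob_space) good_event:
  fixes X :: "real^'p^'n" and z :: "'a \<Rightarrow> real^'n" and w :: "'p set \<Rightarrow> real^'n"
  assumes z: "isotropic_gaussian M z \<sigma>" and \<sigma>: "\<sigma> > 0" and c: "c \<ge> 1"
    and p: "CARD('p) \<ge> 2" and S: "S \<noteq> {}" "nu_set X S > 0"
  defines "L \<equiv> ln (real CARD('p))"
  obtains E where "E \<in> events" "prob E \<ge> 1 - 4 * real CARD('p) powr (- c)"
    "\<And>\<omega> j. \<omega> \<in> E \<Longrightarrow> \<bar>beta_hat X S (z \<omega>) $ j\<bar> \<le> \<sigma> * sqrt (2 * (c + 1) * L) / (sqrt (real CARD('n)) * nu_set X S)"
    "\<And>\<omega> J. \<omega> \<in> E \<Longrightarrow> J \<noteq> S \<Longrightarrow> - (w J \<bullet> z \<omega>) \<le> \<sigma> * norm (w J) * sqrt ((2 * c + 6) * real (card (sym_diff J S)) * L)"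
    "\<And>\<omega> R. \<omega> \<in> E \<Longrightarrow> (norm (orth_proj (colspan X (S \<union> R)) (z \<omega>)))\<^sup>2 - (norm (orth_proj (colspan X S) (z \<omega>)))\<^sup>2
       \<le> \<sigma>\<^sup>2 * (8 / 3 * (c + 4) * real (card R) * L)"
    "\<And>\<omega>. \<omega> \<in> E \<Longrightarrow> (norm (orth_proj (colspan X S) (z \<omega>)))\<^sup>2 \<le> \<sigma>\<^sup>2 * (8 / 3 * (c + 1) * real (card S) * L)"
proof -
  let ?p = "real CARD('p)" and ?P = "\<lambda>J. orth_proj (colspan X J)"
  note [measurable] = isotropic_gaussian_measurable[OF z]
  have Pm [measurable]: "?P J \<in> borel_measurable borel" for J
    by (intro borel_measurable_continuous_onI linear_continuous_on linear_conv_bounded_linear[THEN iffD1]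
        linear_orth_proj subspace_span)
  have L: "L > 0" using p by (simp add: L_def)
  have pe: "?p powr q = exp (q * L)" for q using p by (simp add: powr_def L_def)
  have pm: "?p * ?p powr r = ?p powr (1 + r)" for r using p by (simp add: powr_add)
  \<comment> \<open>The failure probability allowed per element of a set. Summing powers of
    \<open>q\<close> over nonempty sets costs \<open>2 * p * q = 2 * p powr (- (c + 2))\<close>,
    which is at most half of \<open>p powr (- c)\<close> because
    \<open>4 \<le> p\<^sup>2\<close>.\<close>
  define q where "q = ?p powr (- (c + 3))"
  have q0: "0 \<le> q" by (simp add: q_def)
  have pq: "?p * q = ?p powr (- (c + 2))"
    unfolding q_def pm by (simp add: algebra_simps)
  have "?p powr (- (c + 2)) \<le> ?p powr 0" using c p by (intro powr_mono) auto
  then have pq1: "?p * q \<le> 1" using pq p by simp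
  have "?p powr (- 2) \<le> 1 / 4"
  proof -
    have "2\<^sup>2 \<le> ?p\<^sup>2" using p by (intro power_mono) auto
    then show ?thesis using p by (simp add: powr_minus powr_numeral divide_simps)
  qed
  then have "?p powr (- c) * ?p powr (- 2) \<le> ?p powr (- c) * (1 / 4)" by (intro mult_left_mono) auto
  then have pq2: "2 * ?p * q \<le> ?p powr (- c) / 2"
    using pq powr_add[of ?p "- c" "- 2"] by simp

  define A1 where "A1 j = {\<omega> \<in> space M. \<bar>beta_hat X S (z \<omega>) $ j\<bar> > \<sigma> * sqrt (2 * (c + 1) * L) / (sqrt (real CARD('n)) * nu_set X S)}" for j
  have A1: "A1 j \<in> events \<and> prob (A1 j) \<le> 2 * ?p powr (- (c + 1))" for j
  proof -
    obtain u where u: "\<And>z. beta_hat X S z $ j = u \<bullet> z" "norm u \<le> 1 / (sqrt (real CARD('n)) * nu_set X S)"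
      using inner_eq_coord_beta_hat[OF S(2)] by blast
    have "\<sigma> * norm u * sqrt (2 * (c + 1) * L) \<le> \<sigma> * (1 / (sqrt (real CARD('n)) * nu_set X S)) * sqrt (2 * (c + 1) * L)"
      using u(2) \<sigma> c L by (intro mult_right_mono mult_left_mono) auto
    then have "A1 j \<subseteq> {\<omega> \<in> space M. \<bar>u \<bullet> z \<omega>\<bar> > \<sigma> * norm u * sqrt (2 * (c + 1) * L)}"
      unfolding A1_def u(1) by auto
    then have "prob (A1 j) \<le> prob {\<omega> \<in> space M. \<bar>u \<bullet> z \<omega>\<bar> > \<sigma> * norm u * sqrt (2 * (c + 1) * L)}"
      by (intro finite_measure_mono) measurable
    also have "\<dots> \<le> 2 * exp (- (sqrt (2 * (c + 1) * L))\<^sup>2 / 2)"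
      by (rule isotropic_gaussian_tail_abs[OF z \<sigma>]) (use c L in auto)
    also have "- (sqrt (2 * (c + 1) * L))\<^sup>2 / 2 = - (c + 1) * L" using c L by (simp add: field_simps)
    finally have "prob (A1 j) \<le> 2 * ?p powr (- (c + 1))" unfolding pe .
    moreover have "A1 j \<in> events" unfolding A1_def u(1) by measurable
    ultimately show ?thesis by blast
  qed
  have B1: "(\<Union>j\<in>UNIV. A1 j) \<in> events \<and> prob (\<Union>j\<in>UNIV. A1 j) \<le> 2 * ?p powr (- c)"
  proof (rule prob_UN_le[of UNIV A1 "\<lambda>_. 2 * ?p powr (- (c + 1))"])
    show "(\<Sum>j\<in>(UNIV :: 'p set). 2 * ?p powr (- (c + 1))) \<le> 2 * ?p powr (- c)"
      using pm[of "- (c + 1)"] by simp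
  qed (use A1 in auto)

  define A2 where "A2 J = {\<omega> \<in> space M. - (w J \<bullet> z \<omega>) > \<sigma> * norm (w J) * sqrt ((2 * c + 6) * real (card (sym_diff J S)) * L)}" for J
  have A2: "A2 J \<in> events \<and> prob (A2 J) \<le> q ^ card (sym_diff J S)" for J
  proof -
    let ?d = "real (card (sym_diff J S))"
    have "prob (A2 J) \<le> exp (- (sqrt ((2 * c + 6) * ?d * L))\<^sup>2 / 2)"
      using isotropic_gaussian_tail[OF z \<sigma>, of "sqrt ((2 * c + 6) * ?d * L)" "- w J"] c L
      by (simp add: A2_def)
    also have "- (sqrt ((2 * c + 6) * ?d * L))\<^sup>2 / 2 = ?d * (- (c + 3) * L)" using c L by (simp add: field_simps)
    also have "exp \<dots> = q ^ card (sym_diff J S)" unfolding q_def pe by (rule exp_of_nat_mult)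
    finally show ?thesis by (auto simp: A2_def)
  qed
  have B2: "(\<Union>J\<in>UNIV - {S}. A2 J) \<in> events \<and> prob (\<Union>J\<in>UNIV - {S}. A2 J) \<le> ?p powr (- c) / 2"
    by (rule prob_UN_le[OF _ _ _ order_trans[OF sum_power_card_sym_diff_le[OF q0 pq1] pq2]]) (use A2 in auto)

  \<comment> \<open>The thresholds use \<open>b + 1\<close> rather than \<open>b\<close> because one
    power of \<open>p\<close> per column pays for the factor 2 of the quadratic moment
    bound.\<close>
  have tail: "prob {\<omega> \<in> space M. (norm (?P (T \<union> R) (z \<omega>)))\<^sup>2 - (norm (?P T (z \<omega>)))\<^sup>2
      > \<sigma>\<^sup>2 * (8 / 3 * (b + 1) * real (card R) * L)} \<le> (?p powr (- b)) ^ card R" for b T R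
  proof -
    have "prob {\<omega> \<in> space M. (norm (?P (T \<union> R) (z \<omega>)))\<^sup>2 - (norm (?P T (z \<omega>)))\<^sup>2
      > \<sigma>\<^sup>2 * (8 / 3 * (b + 1) * real (card R) * L)} \<le> 2 ^ card R * exp (- 3 / 8 * (8 / 3 * (b + 1) * real (card R) * L))"
      by (rule orth_proj_increment_tail[OF z \<sigma> subspace_span subspace_span span_mono dim_colspan_Un_le]) blast
    also have "- 3 / 8 * (8 / 3 * (b + 1) * real (card R) * L) = real (card R) * (- (b + 1) * L)"
      by (simp add: field_simps)
    also have "exp \<dots> = (?p powr (- (b + 1))) ^ card R" unfolding pe by (rule exp_of_nat_mult)
    also have "2 ^ card R * \<dots> = (2 * ?p powr (- (b + 1))) ^ card R" by (simp add: power_mult_distrib)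
    also have "\<dots> \<le> (?p * ?p powr (- (b + 1))) ^ card R"
      using p by (intro power_mono mult_right_mono) auto
    also have "?p * ?p powr (- (b + 1)) = ?p powr (- b)"
      unfolding pm by simp
    finally show ?thesis .
  qed
  define A3 where "A3 R = {\<omega> \<in> space M. (norm (?P (S \<union> R) (z \<omega>)))\<^sup>2 - (norm (?P S (z \<omega>)))\<^sup>2
      > \<sigma>\<^sup>2 * (8 / 3 * (c + 4) * real (card R) * L)}" for R
  have A3: "A3 R \<in> events \<and> prob (A3 R) \<le> q ^ card R" for R
    using tail[of "c + 3" R S] by (simp add: A3_def q_def add.commute)
  have B3: "(\<Union>R\<in>UNIV - {{}}. A3 R) \<in> events \<and> prob (\<Union>R\<in>UNIV - {{}}. A3 R) \<le> ?p powr (- c) / 2"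
    by (rule prob_UN_le[OF _ _ _ order_trans[OF sum_power_card_nonempty_le[OF q0 pq1] pq2]]) (use A3 in auto)

  define A4 where "A4 = {\<omega> \<in> space M. (norm (?P S (z \<omega>)))\<^sup>2 > \<sigma>\<^sup>2 * (8 / 3 * (c + 1) * real (card S) * L)}"
  \<comment> \<open>The projection onto the columns in \<open>S\<close> is an increment over the
    empty support, so the same tail bound applies; since \<open>S\<close> is nonempty, one power of
    the small factor remains.\<close>
  have "?P {} v = 0" for v by (rule orth_proj_unique) (auto simp: orthogonal_def)
  then have "prob A4 \<le> (?p powr (- c)) ^ card S" using tail[of c S "{}"] by (simp add: A4_def)
  also have "\<dots> \<le> ?p powr (- c)"
  proof -
    have "?p powr (- c) \<le> ?p powr 0" using c p by (intro powr_mono) auto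
    moreover have "1 \<le> card S" using S(1) by (simp add: Suc_leI card_gt_0_iff)
    ultimately show ?thesis using p power_decreasing[of 1 "card S" "?p powr (- c)"] by simp
  qed
  finally have B4: "A4 \<in> events" "prob A4 \<le> ?p powr (- c)" by (auto simp: A4_def)

  define U where "U = ((\<Union>j\<in>UNIV. A1 j) \<union> (\<Union>J\<in>UNIV - {S}. A2 J)) \<union> ((\<Union>R\<in>UNIV - {{}}. A3 R) \<union> A4)"
  have Um: "U \<in> events" unfolding U_def using B1 B2 B3 B4 by blast
  have "prob U \<le> (prob (\<Union>j\<in>UNIV. A1 j) + prob (\<Union>J\<in>UNIV - {S}. A2 J)) + (prob (\<Union>R\<in>UNIV - {{}}. A3 R) + prob A4)"
    unfolding U_def using B1 B2 B3 B4 by (intro order_trans[OF measure_Un_le] add_mono measure_Un_le) blast+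
  also have "\<dots> \<le> 4 * ?p powr (- c)" using B1 B2 B3 B4 by linarith
  finally have U: "prob U \<le> 4 * ?p powr (- c)" .
  show ?thesis
  proof (rule that[of "space M - U"])
    show "space M - U \<in> events" using Um by auto
    show "prob (space M - U) \<ge> 1 - 4 * real CARD('p) powr (- c)" using U prob_compl[OF Um] by simp
    fix \<omega> assume "\<omega> \<in> space M - U"
    then have \<omega>: "\<omega> \<in> space M" "\<omega> \<notin> A1 j" "J \<noteq> S \<Longrightarrow> \<omega> \<notin> A2 J" "R \<noteq> {} \<Longrightarrow> \<omega> \<notin> A3 R" "\<omega> \<notin> A4"
      for j J R unfolding U_def by blast+
    show "\<bar>beta_hat X S (z \<omega>) $ j\<bar> \<le> \<sigma> * sqrt (2 * (c + 1) * L) / (sqrt (real CARD('n)) * nu_set X S)" for j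
      using \<omega>(1) \<omega>(2)[of j] by (simp add: A1_def)
    show "- (w J \<bullet> z \<omega>) \<le> \<sigma> * norm (w J) * sqrt ((2 * c + 6) * real (card (sym_diff J S)) * L)" if "J \<noteq> S" for J
      using \<omega>(1) \<omega>(3)[OF that] by (simp add: A2_def)
    show "(norm (?P (S \<union> R) (z \<omega>)))\<^sup>2 - (norm (?P S (z \<omega>)))\<^sup>2 \<le> \<sigma>\<^sup>2 * (8 / 3 * (c + 4) * real (card R) * L)" for R
      using \<omega>(1) \<omega>(4)[of R] by (cases "R = {}") (auto simp: A3_def)
    show "(norm (?P S (z \<omega>)))\<^sup>2 \<le> \<sigma>\<^sup>2 * (8 / 3 * (c + 1) * real (card S) * L)"
      using \<omega>(1,5) by (simp add: A4_def)
  qed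
qed

section \<open>Posterior concentration\<close>

lemma choose_Suc_le:
  fixes p :: nat
  assumes "a < p"
  shows "p choose Suc a \<le> (p choose a) * p" "p choose a \<le> (p choose Suc a) * p"
proof -
  have e: "Suc a * (p choose Suc a) = (p - a) * (p choose a)"
    using binomial_absorption[of a p] binomial_absorb_comp[of p a] by simp
  have "p choose Suc a \<le> Suc a * (p choose Suc a)" by simp
  also have "\<dots> \<le> p * (p choose a)" unfolding e by (rule mult_right_mono) auto
  finally show "p choose Suc a \<le> (p choose a) * p" by (simp add: mult.commute)
  have "1 * (p choose a) \<le> (p - a) * (p choose a)" using assms by (intro mult_right_mono) auto
  also have "\<dots> \<le> p * (p choose Suc a)" unfolding e[symmetric] using assms by (intro mult_right_mono) auto
  finally show "p choose a \<le> (p choose Suc a) * p" by (simp add: mult.commute)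
qed

lemma choose_add_le:
  fixes p :: nat
  assumes "a + i \<le> p"
  shows "p choose (a + i) \<le> (p choose a) * p ^ i \<and> p choose a \<le> (p choose (a + i)) * p ^ i"
  using assms
proof (induction i)
  case (Suc i)
  then have IH: "p choose (a + i) \<le> (p choose a) * p ^ i" "p choose a \<le> (p choose (a + i)) * p ^ i"
    and s: "a + i < p" by auto
  have "p choose (a + Suc i) \<le> (p choose (a + i)) * p" using choose_Suc_le(1)[OF s] by simp
  also have "\<dots> \<le> (p choose a) * p ^ i * p" using IH by (intro mult_right_mono) auto
  finally have 1: "p choose (a + Suc i) \<le> (p choose a) * p ^ Suc i" by (simp add: mult_ac)
  have "(p choose (a + i)) * p ^ i \<le> (p choose Suc (a + i)) * p * p ^ i"
    using choose_Suc_le(2)[OF s] by (intro mult_right_mono) auto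
  with IH(2) have "p choose a \<le> (p choose Suc (a + i)) * p * p ^ i" by (rule le_trans)
  then have 2: "p choose a \<le> (p choose (a + Suc i)) * p ^ Suc i" by (simp add: mult_ac)
  show ?case using 1 2 by blast
qed simp

text \<open>Controls the binomial part of the prior ratio: each unit of difference in size costs at
  most a factor \<open>p\<close>, in either direction.\<close>

lemma choose_le_choose_mult_power:
  fixes p :: nat
  assumes "a \<le> p" "b \<le> p" "a \<le> b + k" "b \<le> a + k" "p \<ge> 1"
  shows "p choose a \<le> (p choose b) * p ^ k"
proof -
  have "p choose a \<le> (p choose b) * p ^ (if a \<le> b then b - a else a - b)"
    using choose_add_le[of a "b - a" p] choose_add_le[of b "a - b" p] assms by auto
  also have "\<dots> \<le> (p choose b) * p ^ k"
    using assms by (intro mult_left_mono power_increasing) auto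
  finally show ?thesis .
qed

section \<open>The deterministic model and the strength of the signal\<close>

locale sparse_model =
  fixes X :: "real^'p^'n" and \<beta> :: "real^'p" and \<sigma> lam \<epsilon> c L :: real and s sbar :: nat
  assumes L_def: "L = ln (real CARD('p))"
    and sigma: "\<sigma> > 0"
    and s_def: "s = card (supp \<beta>)"
    and s: "1 \<le> s" "s \<le> sbar" "sbar \<le> CARD('p)"
    and card_p: "2 \<le> CARD('p)"
    and eps: "\<epsilon> > 0"
    and c: "c \<ge> 1"
    and I: "cond_I X ((2 + \<epsilon>) * real s)"
    and lambda: "lam = ((1 + \<epsilon>) * (23 + 5 * c) + 1) / \<epsilon> * L"
    and beta_min: "Min ((\<lambda>j. \<bar>\<beta> $ j\<bar>) ` supp \<beta>)
          \<ge> 3 * \<sigma> * sqrt (lam / real CARD('n)) / nu X ((2 + \<epsilon>) * real s)"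
begin

abbreviation "S \<equiv> supp \<beta>"
abbreviation "m \<equiv> X *v \<beta>"
abbreviation "P J \<equiv> orth_proj (colspan X J)"
abbreviation "dist_S J \<equiv> card (sym_diff J S)"

definition bias :: "'p set \<Rightarrow> real^'n" where "bias J = m - P J m"

lemma L_pos: "L > 0" using card_p by (simp add: L_def)

lemma powr_p: "real CARD('p) powr a = exp (a * L)" using card_p by (simp add: powr_def L_def)

lemma S_nonempty: "S \<noteq> {}" using s s_def by auto

lemma lam_ge: "lam \<ge> (23 + 5 * c) * L"
proof -
  have "23 + 5 * c \<le> ((1 + \<epsilon>) * (23 + 5 * c) + 1) / \<epsilon>" using eps c by (simp add: field_simps)
  then show ?thesis unfolding lambda by (intro mult_right_mono) (use L_pos in auto)
qed

text \<open>With \<open>r > (1 + \<epsilon>) * s\<close> false elements, even missing all of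
  \<open>S\<close> leaves a net excess \<open>r - s\<close> of at least
  \<open>\<epsilon> / (1 + \<epsilon>) * r\<close>; only this share of the penalty can be counted
  on.\<close>

lemma lam_mult_eps_ge: "lam * \<epsilon> \<ge> (1 + \<epsilon>) * ((23 + 5 * c) * L)"
proof -
  have "lam * \<epsilon> = (1 + \<epsilon>) * ((23 + 5 * c) * L) + L" using eps by (simp add: lambda field_simps)
  then show ?thesis using L_pos by simp
qed

lemma lam_pos: "lam > 0"
proof -
  have "(23 + 5 * c) * L > 0" using c L_pos by simp
  then show ?thesis using lam_ge by linarith
qed

lemma inj_cols_S: "inj_cols X S" and nu_set_S_pos: "nu_set X S > 0"
proof -
  have "real s * 1 \<le> real s * (2 + \<epsilon>)" using eps by (intro mult_left_mono) auto
  then show i: "inj_cols X S" by (intro cond_I_inj_cols[OF I]) (simp add: s_def mult.commute)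
  show "nu_set X S > 0" by (rule nu_set_pos[OF S_nonempty i])
qed

lemma P_m: "S \<subseteq> J \<Longrightarrow> P J m = m"
  by (intro orth_proj_id subspace_span mult_in_colspan)

text \<open>The projected signal is \<open>X *v u\<close> with \<open>u\<close> supported in
  \<open>J\<close>, so the bias is the image of \<open>\<beta> - u\<close>, whose support is small
  enough for \<open>nu\<close>. On \<open>S - J\<close> this vector agrees with
  \<open>\<beta>\<close>, and the factor 3 of the beta-min condition becomes 9 when squared.\<close>

lemma signal_strength:
  assumes "real (card (J \<union> S)) \<le> (2 + \<epsilon>) * real s"
  shows "9 * lam * real (card (S - J)) * \<sigma>\<^sup>2 \<le> (norm (bias J))\<^sup>2"
proof -
  let ?\<nu> = "nu X ((2 + \<epsilon>) * real s)"
  have "1 * 1 \<le> (2 + \<epsilon>) * real s" using eps s(1) by (intro mult_mono) auto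
  then have \<nu>: "?\<nu> > 0" by (intro nu_pos[OF I]) simp
  have "card S \<le> card (J \<union> S)" by (intro card_mono) auto
  then have "1 \<le> card (J \<union> S)" using s(1) s_def by simp
  then have \<nu>K: "?\<nu> \<le> nu_set X (J \<union> S)" using assms by (rule nu_le_nu_set)
  obtain u where u: "supp u \<subseteq> J" "P J m = X *v u"
    using colspanE[OF orth_proj_mem[OF subspace_span]] by metis
  define w where "w = \<beta> - u"
  have "supp w \<subseteq> J \<union> S" using supp_diff_subset[of \<beta> u] u(1) by (auto simp: w_def)
  then have "sqrt (real CARD('n)) * nu_set X (J \<union> S) * norm w \<le> norm (X *v w)" by (rule nu_set_bound)
  also have "X *v w = bias J" by (simp add: w_def bias_def u(2) matrix_vector_mult_diff_distrib)
  finally have "sqrt (real CARD('n)) * ?\<nu> * norm w \<le> norm (bias J)"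
    by (rule order_trans[rotated]) (intro mult_right_mono mult_left_mono \<nu>K, auto)
  then have "(sqrt (real CARD('n)) * ?\<nu> * norm w)\<^sup>2 \<le> (norm (bias J))\<^sup>2" using \<nu> by (intro power_mono) auto
  then have b: "real CARD('n) * ?\<nu>\<^sup>2 * (norm w)\<^sup>2 \<le> (norm (bias J))\<^sup>2" by (simp add: power_mult_distrib)
  define b where "b = 3 * \<sigma> * sqrt (lam / real CARD('n)) / ?\<nu>"
  have "b\<^sup>2 * real (card (S - J)) = (\<Sum>j\<in>S - J. b\<^sup>2)" by simp
  also have "\<dots> \<le> (\<Sum>j\<in>S - J. (w $ j)\<^sup>2)"
  proof (intro sum_mono)
    fix j assume j: "j \<in> S - J"
    then have "b \<le> \<bar>\<beta> $ j\<bar>" unfolding b_def using beta_min by (intro order_trans[OF beta_min] Min_le) auto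
    moreover have "w $ j = \<beta> $ j" using j u(1) by (auto simp: w_def supp_subset_iff)
    moreover have "b \<ge> 0" using sigma \<nu> lam_pos by (simp add: b_def)
    ultimately show "b\<^sup>2 \<le> (w $ j)\<^sup>2" by (metis abs_of_nonneg abs_le_square_iff)
  qed
  also have "\<dots> \<le> (\<Sum>j\<in>UNIV. (w $ j)\<^sup>2)" by (rule sum_mono2) auto
  also have "\<dots> = (norm w)\<^sup>2"
    by (simp only: power2_norm_eq_inner inner_vec_def) (simp add: power2_eq_square)
  finally have "real CARD('n) * ?\<nu>\<^sup>2 * (b\<^sup>2 * real (card (S - J))) \<le> real CARD('n) * ?\<nu>\<^sup>2 * (norm w)\<^sup>2"
    by (intro mult_left_mono) auto
  moreover have "real CARD('n) * ?\<nu>\<^sup>2 * b\<^sup>2 = 9 * lam * \<sigma>\<^sup>2"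
    using \<nu> lam_pos by (simp add: b_def power_mult_distrib power_divide)
  ultimately show ?thesis using b by (simp add: mult.assoc[symmetric]) (simp add: mult_ac)
qed

end

section \<open>Arithmetic of the log posterior ratio\<close>

lemma exponent_bound_few_false:
  fixes r t w x c L lam M :: real
  assumes L: "L > 0" and c: "c \<ge> 1" and rt: "0 \<le> r" "0 \<le> t" "1 \<le> r + t"
    and lam: "lam \<ge> (23 + 5 * c) * L" and w: "w\<^sup>2 \<ge> 9 * lam * t"
    and x: "x\<^sup>2 = (2 * c + 6) * (r + t) * L" and M: "M \<le> r + t"
  shows "- lam * (r - t) + M * L + (4 / 3 * (c + 4) * r * L + w * x - w\<^sup>2 / 2)
    \<le> - (1 + 4 * c / 3) * L - 4 * (r + t) * L - w\<^sup>2 / 16"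
proof -
  \<comment> \<open>Of the remaining \<open>- w\<^sup>2 / 4\<close>, one quarter is kept for the
    conclusion. The other \<open>3 / 16 * w\<^sup>2 \<ge> 27 / 16 * lam * t\<close> cancels the
    prior gain \<open>lam * t\<close> from missed elements and leaves
    \<open>11 / 16 * lam * t\<close>. Its coefficient \<open>55 / 16\<close> of
    \<open>c * L * t\<close> has to cover \<open>10 / 3\<close>.\<close>
  have "w * x \<le> w\<^sup>2 / 4 + x\<^sup>2"
    using zero_le_power2[of "w / 2 - x"] by (simp add: power2_eq_square algebra_simps)
  moreover have "M * L \<le> (r + t) * L" using M L by (intro mult_right_mono) auto
  moreover have "(1 + 4 * c / 3) * L * 1 \<le> (1 + 4 * c / 3) * L * (r + t)"
    using rt c L by (intro mult_left_mono) auto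
  moreover have "(23 + 5 * c) * L * r \<le> lam * r" using lam rt by (intro mult_right_mono) auto
  moreover have "(23 + 5 * c) * L * t \<le> lam * t" using lam rt by (intro mult_right_mono) auto
  moreover have "0 \<le> L * r" "0 \<le> L * t" "0 \<le> c * (L * r)" "0 \<le> c * (L * t)" using L rt c by auto
  ultimately show ?thesis using w x
    by (simp only: algebra_simps add_divide_distrib diff_divide_distrib) argo
qed

text \<open>No lower bound on \<open>w\<close> is available here, so the penalty on \<open>r\<close>
  pays for everything. With \<open>t \<le> r\<close> and \<open>2 \<le> r\<close>, which halves the
  share of the fixed term, the costs stay below \<open>22 + 13 * c / 3\<close> times
  \<open>L\<close> per false element.\<close>

lemma exponent_bound_many_false:
  fixes r t w x c L lam :: real
  assumes L: "L > 0" and c: "c \<ge> 1" and rt: "2 \<le> r" "0 \<le> t" "t \<le> r"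
    and lam: "lam * (r - t) \<ge> (23 + 5 * c) * L * r"
    and x: "x\<^sup>2 = (2 * c + 6) * (r + t) * L"
  shows "- lam * (r - t) + r * L + (4 / 3 * (c + 4) * r * L + w * x - w\<^sup>2 / 2)
    \<le> - (1 + 4 * c / 3) * L - 4 * (r + t) * L - w\<^sup>2 / 16"
proof -
  \<comment> \<open>The weight 7/16 is the largest that leaves \<open>- w\<^sup>2 / 16\<close> from
    \<open>- w\<^sup>2 / 2\<close>, which makes the weight on \<open>x\<^sup>2\<close> as small as
    possible.\<close>
  have "w * x \<le> 7 / 16 * w\<^sup>2 + 4 / 7 * x\<^sup>2"
    using zero_le_power2[of "7 * w - 8 * x"] by (simp add: power2_eq_square algebra_simps)
  moreover have "L * t \<le> L * r" "c * (L * t) \<le> c * (L * r)" using rt c L by auto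
  moreover have "L * 2 \<le> L * r" "c * (L * 2) \<le> c * (L * r)" using rt c L by auto
  moreover have "0 \<le> L * r" "0 \<le> c * (L * r)" using L rt c by auto
  ultimately show ?thesis using lam x
    by (simp only: algebra_simps add_divide_distrib diff_divide_distrib) argo
qed

text \<open>One realization of the noise in the good event, with \<open>bias\<close> as the family
  of functionals. Everything derived here is deterministic.\<close>

locale good_noise = sparse_model X \<beta> \<sigma> lam \<epsilon> c L s sbar
  for X :: "real^'p^'n" and \<beta> :: "real^'p" and \<sigma> lam \<epsilon> c L :: real and s sbar :: nat +
  fixes z :: "real^'n"
  assumes noise_coord: "\<And>j. \<bar>beta_hat X S z $ j\<bar> \<le> \<sigma> * sqrt (2 * (c + 1) * L) / (sqrt (real CARD('n)) * nu_set X S)"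
    and noise_bias: "\<And>J. J \<noteq> S \<Longrightarrow> - (bias J \<bullet> z) \<le> \<sigma> * norm (bias J) * sqrt ((2 * c + 6) * real (dist_S J) * L)"
    and noise_proj: "\<And>R. (norm (P (S \<union> R) z))\<^sup>2 - (norm (P S z))\<^sup>2 \<le> \<sigma>\<^sup>2 * (8 / 3 * (c + 4) * real (card R) * L)"
    and noise_proj_S: "(norm (P S z))\<^sup>2 \<le> \<sigma>\<^sup>2 * (8 / 3 * (c + 1) * real (card S) * L)"
begin

abbreviation "y \<equiv> m + z"
abbreviation "\<rho> \<equiv> posterior X \<sigma> lam sbar y"

definition ratio :: "'p set \<Rightarrow> real" where
  "ratio J = real CARD('p) powr (- (1 + 4 * c / 3)) * (real CARD('p) powr (- 4)) ^ dist_S J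
    * exp (- (norm (bias J))\<^sup>2 / (16 * \<sigma>\<^sup>2))"

text \<open>The residual on \<open>S\<close> is pure noise since \<open>S\<close> carries the
  signal. On \<open>J\<close> the bias is orthogonal to the column span, so the cross term is just
  \<open>bias J \<bullet> z\<close>. Enlarging \<open>J\<close> to \<open>S \<union> (J - S)\<close>
  charges the noise projection for false elements only.\<close>

lemma resid_diff_le:
  assumes "J \<noteq> S"
  shows "(norm (resid X S y))\<^sup>2 - (norm (resid X J y))\<^sup>2
    \<le> \<sigma>\<^sup>2 * (8 / 3 * (c + 4) * real (card (J - S)) * L)
      + 2 * (\<sigma> * norm (bias J) * sqrt ((2 * c + 6) * real (dist_S J) * L)) - (norm (bias J))\<^sup>2"
proof -
  have lin: "P J (m + z) = P J m + P J z" for J by (rule linear_add[OF linear_orth_proj[OF subspace_span]])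
  have py: "(norm (z - P J z))\<^sup>2 = (norm z)\<^sup>2 - (norm (P J z))\<^sup>2" for J
    using norm_orth_proj_pythagoras[OF subspace_span, of z "(\<lambda>j. column j X) ` J"] by simp
  have S: "resid X S y = z - P S z" by (simp add: resid_def lin P_m)
  have J: "resid X J y = bias J + (z - P J z)" by (simp add: resid_def lin bias_def)
  have "bias J \<bullet> P J z = 0"
    using orth_proj_orthogonal[OF subspace_span orth_proj_mem[OF subspace_span]]
    by (metis bias_def orthogonal_def)
  then have "(norm (resid X J y))\<^sup>2 = (norm (bias J))\<^sup>2 + 2 * (bias J \<bullet> z) + (norm (z - P J z))\<^sup>2"
    unfolding J power2_norm_eq_inner
    by (simp add: inner_add_left inner_add_right inner_diff_right inner_commute)
  then have "(norm (resid X S y))\<^sup>2 - (norm (resid X J y))\<^sup>2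
    = (norm (P J z))\<^sup>2 - (norm (P S z))\<^sup>2 + 2 * - (bias J \<bullet> z) - (norm (bias J))\<^sup>2"
    unfolding S py by simp
  moreover have "(norm (P J z))\<^sup>2 \<le> (norm (P (S \<union> (J - S)) z))\<^sup>2"
    by (intro power_mono norm_orth_proj_mono subspace_span span_mono) auto
  ultimately show ?thesis using noise_proj[of "J - S"] noise_bias[OF assms] by linarith
qed

lemma prior_weight_nonneg: "prior_weight a b J \<ge> 0"
  by (simp add: prior_weight_def)

lemma post_weight_nonneg: "post_weight X \<sigma> lam sbar v J \<ge> 0"
  unfolding post_weight_def prior_def
  by (intro mult_nonneg_nonneg divide_nonneg_nonneg sum_nonneg prior_weight_nonneg) auto

lemma card_S_le: "card S \<le> CARD('p)" by (intro card_mono) auto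

lemma post_weight_ratio:
  assumes "J \<noteq> S"
  shows "post_weight X \<sigma> lam sbar y J \<le> post_weight X \<sigma> lam sbar y S * ratio J"
proof (cases "card J \<le> sbar")
  case False
  then have "post_weight X \<sigma> lam sbar y J = 0" by (simp add: post_weight_def prior_def prior_weight_def)
  then show ?thesis using post_weight_nonneg[of y S] by (simp add: ratio_def)
next
  case True
  define r t where "r = card (J - S)" and "t = card (S - J)"
  \<comment> \<open>An upper bound for the size difference between \<open>J\<close> and
    \<open>S\<close>, which is the difference of \<open>r\<close> and \<open>t\<close>. In the
    second case \<open>t \<le> s < r\<close>, so \<open>r\<close> alone suffices.\<close>
  define k where "k = (if real r \<le> (1 + \<epsilon>) * real s then r + t else r)"
  define w where "w = norm (bias J) / \<sigma>"
  define x where "x = sqrt ((2 * c + 6) * (real r + real t) * L)"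
  define \<delta> where "\<delta> = ((norm (resid X S y))\<^sup>2 - (norm (resid X J y))\<^sup>2) / (2 * \<sigma>\<^sup>2)"
  have d: "dist_S J = r + t" unfolding r_def t_def by (rule card_Un_disjoint) auto
  have "J - S \<noteq> {} \<or> S - J \<noteq> {}" using assms by blast
  then have rt: "1 \<le> r + t" unfolding r_def t_def by (auto simp: Suc_le_eq card_gt_0_iff)
  have "card (J \<inter> S) + card (J - S) = card J" by (metis card_Int_Diff finite)
  moreover have "card (J \<inter> S) + card (S - J) = card S" by (metis card_Int_Diff finite Int_commute)
  ultimately have cJ: "card J + t = s + r" by (simp add: r_def t_def s_def)
  have ts: "t \<le> s" unfolding t_def s_def by (intro card_mono) auto
  have x2: "x\<^sup>2 = (2 * c + 6) * (real r + real t) * L" using c L_pos by (simp add: x_def)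
  have \<delta>: "\<delta> \<le> 4 / 3 * (c + 4) * real r * L + w * x - w\<^sup>2 / 2"
  proof -
    have "\<delta> \<le> (\<sigma>\<^sup>2 * (8 / 3 * (c + 4) * real r * L)
      + 2 * (\<sigma> * norm (bias J) * x) - (norm (bias J))\<^sup>2) / (2 * \<sigma>\<^sup>2)"
      unfolding \<delta>_def using resid_diff_le[OF assms] sigma
      by (intro divide_right_mono) (auto simp: r_def[symmetric] d x_def)
    also have "\<dots> = 4 / 3 * (c + 4) * real r * L + w * x - w\<^sup>2 / 2"
      using sigma by (simp add: w_def field_simps power2_eq_square)
    finally show ?thesis .
  qed
  have expo: "- lam * (real r - real t) + real k * L + \<delta>
    \<le> - (1 + 4 * c / 3) * L - 4 * (real r + real t) * L - w\<^sup>2 / 16"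
    and kk: "card J \<le> s + k" "s \<le> card J + k"
  proof -
    have "- lam * (real r - real t) + real k * L + (4 / 3 * (c + 4) * real r * L + w * x - w\<^sup>2 / 2)
      \<le> - (1 + 4 * c / 3) * L - 4 * (real r + real t) * L - w\<^sup>2 / 16 \<and> card J \<le> s + k \<and> s \<le> card J + k"
    proof (cases "real r \<le> (1 + \<epsilon>) * real s")
      case few: True
      have "card (J \<union> S) = card (J - S) + card S"
        using card_Un_disjoint[of "J - S" S] by (auto simp: Un_Diff_cancel2)
      then have "real (card (J \<union> S)) = real r + real s" by (simp add: r_def s_def)
      then have "real (card (J \<union> S)) \<le> (2 + \<epsilon>) * real s" using few by (simp add: algebra_simps)
      from signal_strength[OF this] have w2: "9 * lam * real t \<le> w\<^sup>2"
        using sigma by (simp add: w_def t_def power_divide pos_le_divide_eq)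
      show ?thesis
        using exponent_bound_few_false[OF L_pos c _ _ _ lam_ge w2 x2, of "real k"] rt cJ few
        by (simp add: k_def)
    next
      case many: False
      \<comment> \<open>Besides \<open>t < r\<close>, this yields \<open>2 \<le> r\<close> because
        \<open>1 \<le> s\<close>.\<close>
      have "1 * real s < (1 + \<epsilon>) * real s" using eps s(1) by (intro mult_strict_right_mono) auto
      then have rs: "s < r" using many by linarith
      have "(1 + \<epsilon>) * (lam * (real r - real s)) \<ge> lam * \<epsilon> * real r"
      proof -
        have "lam * ((1 + \<epsilon>) * real s) \<le> lam * real r" using many lam_pos by (intro mult_left_mono) auto
        then show ?thesis by (simp add: algebra_simps)
      qed
      moreover have "lam * \<epsilon> * real r \<ge> (1 + \<epsilon>) * ((23 + 5 * c) * L) * real r"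
        using lam_mult_eps_ge by (intro mult_right_mono) auto
      ultimately have "(1 + \<epsilon>) * ((23 + 5 * c) * L * real r) \<le> (1 + \<epsilon>) * (lam * (real r - real s))"
        by (simp only: mult.assoc)
      then have "(23 + 5 * c) * L * real r \<le> lam * (real r - real s)" using eps by simp
      also have "\<dots> \<le> lam * (real r - real t)" using lam_pos ts by (intro mult_left_mono) auto
      finally have l: "(23 + 5 * c) * L * real r \<le> lam * (real r - real t)" .
      show ?thesis
        using exponent_bound_many_false[OF L_pos c _ _ _ l x2] rs ts s(1) cJ many by (simp add: k_def)
    qed
    then show "- lam * (real r - real t) + real k * L + \<delta>
      \<le> - (1 + 4 * c / 3) * L - 4 * (real r + real t) * L - w\<^sup>2 / 16"
      "card J \<le> s + k" "s \<le> card J + k" using \<delta> by linarith+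
  qed
  have ps: "s \<le> CARD('p)" "card J \<le> CARD('p)" using s True by auto
  \<comment> \<open>The binomials stand in the denominators of the prior weights, so it is the one
    at \<open>s\<close> that needs an upper bound.\<close>
  have "CARD('p) choose s \<le> (CARD('p) choose card J) * CARD('p) ^ k"
    using choose_le_choose_mult_power[OF ps kk(2,1)] card_p by simp
  then have "real (CARD('p) choose s) \<le> real (CARD('p) choose card J) * exp (real k * L)"
    using card_p unfolding exp_of_nat_mult
    by (metis L_def exp_ln of_nat_0_less_iff of_nat_le_iff of_nat_mult of_nat_power zero_less_card_finite)
  then have "1 / real (CARD('p) choose card J) \<le> exp (real k * L) / real (CARD('p) choose s)"
    using ps by (simp add: divide_simps zero_less_binomial mult.commute)
  then have "exp (- lam * real (card J)) * (1 / real (CARD('p) choose card J))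
    \<le> exp (- lam * real (card J)) * (exp (real k * L) / real (CARD('p) choose s))"
    by (intro mult_left_mono) auto
  also have "\<dots> = exp (- lam * real s) / real (CARD('p) choose s) * exp (- lam * (real r - real t) + real k * L)"
  proof -
    have e: "real (card J) = real s + (real r - real t)" using cJ by linarith
    show ?thesis unfolding e by (simp add: algebra_simps flip: exp_add)
  qed
  finally have "prior_weight lam sbar J \<le> prior_weight lam sbar S * exp (- lam * (real r - real t) + real k * L)"
    using True s(2) unfolding prior_weight_def s_def[symmetric]
    by simp
  then have "prior lam sbar J \<le> prior lam sbar S * exp (- lam * (real r - real t) + real k * L)"
    unfolding prior_def times_divide_eq_left
    by (intro divide_right_mono sum_nonneg prior_weight_nonneg)
  then have "prior lam sbar J * exp (- ((norm (resid X J y))\<^sup>2 / (2 * \<sigma>\<^sup>2)))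
    \<le> prior lam sbar S * exp (- lam * (real r - real t) + real k * L) * exp (- ((norm (resid X J y))\<^sup>2 / (2 * \<sigma>\<^sup>2)))"
    by (intro mult_right_mono) auto
  also have "\<dots> = prior lam sbar S * exp (- lam * (real r - real t) + real k * L)
      * (exp (- ((norm (resid X S y))\<^sup>2 / (2 * \<sigma>\<^sup>2))) * exp \<delta>)"
    unfolding exp_add[symmetric] by (simp add: \<delta>_def diff_divide_distrib)
  finally have "post_weight X \<sigma> lam sbar y J
    \<le> post_weight X \<sigma> lam sbar y S * exp (- lam * (real r - real t) + real k * L + \<delta>)"
    by (simp add: post_weight_def exp_add mult_ac)
  also have "\<dots> \<le> post_weight X \<sigma> lam sbar y S
      * exp (- (1 + 4 * c / 3) * L - 4 * (real r + real t) * L - w\<^sup>2 / 16)"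
    using expo by (intro mult_left_mono post_weight_nonneg) simp
  also have "exp (- (1 + 4 * c / 3) * L - 4 * (real r + real t) * L - w\<^sup>2 / 16) = ratio J"
  proof -
    have "(real CARD('p) powr (- 4)) ^ dist_S J = exp (real (r + t) * (- 4 * L))"
      unfolding powr_p d exp_of_nat_mult ..
    then show ?thesis unfolding ratio_def
      by (simp add: powr_p w_def power_divide algebra_simps flip: exp_add)
  qed
  finally show ?thesis .
qed

lemma post_weight_S_pos: "post_weight X \<sigma> lam sbar y S > 0"
proof -
  have "prior_weight lam sbar S > 0"
    using s card_S_le by (simp add: prior_weight_def s_def[symmetric] zero_less_binomial)
  then show ?thesis unfolding post_weight_def prior_def
    by (intro mult_pos_pos divide_pos_pos sum_pos2[of _ S] prior_weight_nonneg) auto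
qed

lemma post_weight_sum_pos: "(\<Sum>K\<in>UNIV. post_weight X \<sigma> lam sbar y K) > 0"
  by (intro sum_pos2[of _ S] post_weight_S_pos post_weight_nonneg) auto

lemma posterior_nonneg: "\<rho> J \<ge> 0"
  unfolding posterior_def using post_weight_sum_pos post_weight_nonneg by simp

lemma posterior_sum: "(\<Sum>J\<in>UNIV. \<rho> J) = 1"
  unfolding posterior_def using post_weight_sum_pos by (simp flip: sum_divide_distrib)

lemma posterior_S_le: "\<rho> S \<le> 1"
proof -
  have "\<rho> S \<le> (\<Sum>J\<in>UNIV. \<rho> J)" by (rule member_le_sum) (auto simp: posterior_nonneg)
  then show ?thesis unfolding posterior_sum .
qed

lemma ratio_nonneg: "ratio J \<ge> 0" by (simp add: ratio_def)

lemma posterior_le_ratio: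
  assumes "J \<noteq> S" shows "\<rho> J \<le> ratio J"
proof -
  have "\<rho> J \<le> \<rho> S * ratio J"
    unfolding posterior_def times_divide_eq_left
    using post_weight_ratio[OF assms] post_weight_sum_pos by (intro divide_right_mono) auto
  also have "\<dots> \<le> 1 * ratio J" by (intro mult_right_mono posterior_S_le ratio_nonneg)
  finally show ?thesis by simp
qed

text \<open>The factor \<open>2 p\<^sup>-\<^sup>3\<close> bounds the sum of \<open>p\<close> to the power \<open>- 4 * dist_S J\<close> over all \<open>J \<noteq> S\<close>.\<close>
definition \<kappa> :: real where "\<kappa> = real CARD('p) powr (- (1 + 4 * c / 3)) * (2 * real CARD('p) powr (- 3))"

lemma powr_p_le: "a \<le> b \<Longrightarrow> real CARD('p) powr a \<le> real CARD('p) powr b"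
  using card_p by (intro powr_mono) auto

lemma p_powr_minus_3: "2 * real CARD('p) powr (- 3) \<le> 1"
proof -
  have "real CARD('p) powr (- 3) \<le> real CARD('p) powr (- 1)" by (rule powr_p_le) simp
  also have "\<dots> \<le> 1 / 2" using card_p by (simp add: powr_minus divide_simps)
  finally show ?thesis by simp
qed

lemma sum_dist_weights_le:
  "(\<Sum>J\<in>UNIV - {S}. real CARD('p) powr (- (1 + 4 * c / 3)) * (real CARD('p) powr (- 4)) ^ dist_S J) \<le> \<kappa>"
proof -
  have e: "real CARD('p) * real CARD('p) powr (- 4) = real CARD('p) powr (- 3)"
    using card_p by (simp add: powr_mult_base)
  have "(\<Sum>J\<in>UNIV - {S}. (real CARD('p) powr (- 4)) ^ dist_S J) \<le> 2 * real CARD('p) * real CARD('p) powr (- 4)"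
    by (rule sum_power_card_sym_diff_le) (use e p_powr_minus_3 in auto)
  then have "(\<Sum>J\<in>UNIV - {S}. (real CARD('p) powr (- 4)) ^ dist_S J) \<le> 2 * real CARD('p) powr (- 3)"
    using e by simp
  then show ?thesis unfolding \<kappa>_def sum_distrib_left[symmetric] by (intro mult_left_mono) auto
qed

lemma sum_posterior_wrong_le: "(\<Sum>J\<in>UNIV - {S}. \<rho> J) \<le> \<kappa>"
proof -
  have "\<rho> J \<le> real CARD('p) powr (- (1 + 4 * c / 3)) * (real CARD('p) powr (- 4)) ^ dist_S J"
    if "J \<noteq> S" for J
  proof -
    have "ratio J \<le> real CARD('p) powr (- (1 + 4 * c / 3)) * (real CARD('p) powr (- 4)) ^ dist_S J * 1"
      unfolding ratio_def by (intro mult_left_mono) auto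
    then show ?thesis using posterior_le_ratio[OF that] by simp
  qed
  then show ?thesis by (intro order_trans[OF sum_mono sum_dist_weights_le]) auto
qed

text \<open>The exponential factor of \<open>ratio\<close> absorbs the bias however large the
  signal: with \<open>w = norm (bias J) / \<sigma>\<close>, the chain
  \<open>w / 2 \<le> 1 + w\<^sup>2 / 16 \<le> exp (w\<^sup>2 / 16)\<close> gives
  \<open>w * exp (- (w\<^sup>2 / 16)) \<le> 2\<close>.\<close>

lemma sum_posterior_bias_le: "(\<Sum>J\<in>UNIV - {S}. \<rho> J * norm (bias J)) \<le> 2 * \<sigma> * \<kappa>"
proof -
  have "\<rho> J * norm (bias J) \<le> 2 * \<sigma> * (real CARD('p) powr (- (1 + 4 * c / 3)) * (real CARD('p) powr (- 4)) ^ dist_S J)"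
    if "J \<noteq> S" for J
  proof -
    define w where "w = norm (bias J) / \<sigma>"
    have nb: "norm (bias J) = \<sigma> * w" using sigma by (simp add: w_def)
    have "w / 2 \<le> 1 + w\<^sup>2 / 16" using zero_le_power2[of "w - 4"] by (simp add: power2_diff)
    also have "\<dots> \<le> exp (w\<^sup>2 / 16)" by (rule exp_ge_add_one_self)
    finally have "w * exp (- (w\<^sup>2 / 16)) \<le> 2" by (simp add: exp_minus field_simps)
    moreover have "ratio J = real CARD('p) powr (- (1 + 4 * c / 3)) * (real CARD('p) powr (- 4)) ^ dist_S J * exp (- (w\<^sup>2 / 16))"
      by (simp add: ratio_def w_def power_divide)
    ultimately have "ratio J * (\<sigma> * w) \<le> (real CARD('p) powr (- (1 + 4 * c / 3)) * (real CARD('p) powr (- 4)) ^ dist_S J * \<sigma>) * 2"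
      using sigma mult_left_mono[of "w * exp (- (w\<^sup>2 / 16))" 2
        "real CARD('p) powr (- (1 + 4 * c / 3)) * (real CARD('p) powr (- 4)) ^ dist_S J * \<sigma>"]
      by (simp add: mult_ac)
    moreover have "\<rho> J * norm (bias J) \<le> ratio J * norm (bias J)"
      by (intro mult_right_mono posterior_le_ratio[OF that]) auto
    ultimately show ?thesis unfolding nb by (simp add: mult_ac)
  qed
  then have "(\<Sum>J\<in>UNIV - {S}. \<rho> J * norm (bias J))
    \<le> (\<Sum>J\<in>UNIV - {S}. 2 * \<sigma> * (real CARD('p) powr (- (1 + 4 * c / 3)) * (real CARD('p) powr (- 4)) ^ dist_S J))"
    by (intro sum_mono) auto
  also have "\<dots> \<le> 2 * \<sigma> * \<kappa>"
    unfolding sum_distrib_left[symmetric] using sigma sum_dist_weights_le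
    by (intro mult_left_mono) (auto simp: sum_distrib_left)
  finally show ?thesis .
qed

text \<open>Adding the bound on \<open>S\<close> to the bound on the increment controls the whole
  projection for every \<open>J\<close> at once. The constant \<open>20 + 4 * c\<close> dominates
  both \<open>8 / 3 * (c + 4)\<close> and \<open>8 / 3 * (c + 1)\<close>.\<close>

lemma norm_proj_noise_le: "norm (P J z) \<le> real CARD('p) * (\<sigma> * sqrt ((20 + 4 * c) * L))"
proof -
  have "(norm (P J z))\<^sup>2 \<le> (norm (P (S \<union> (J - S)) z))\<^sup>2"
    by (intro power_mono norm_orth_proj_mono subspace_span span_mono) auto
  also have "\<dots> \<le> \<sigma>\<^sup>2 * (8 / 3 * (c + 4) * real (card (J - S)) * L) + \<sigma>\<^sup>2 * (8 / 3 * (c + 1) * real (card S) * L)"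
    using noise_proj[of "J - S"] noise_proj_S by linarith
  also have "\<dots> \<le> \<sigma>\<^sup>2 * ((20 + 4 * c) * real (card (J - S)) * L) + \<sigma>\<^sup>2 * ((20 + 4 * c) * real (card S) * L)"
    using c L_pos by (intro add_mono mult_left_mono mult_right_mono) auto
  also have "\<dots> = \<sigma>\<^sup>2 * ((20 + 4 * c) * real (card (J - S) + card S) * L)" by (simp add: algebra_simps)
  also have "\<dots> \<le> \<sigma>\<^sup>2 * ((20 + 4 * c) * (real CARD('p))\<^sup>2 * L)"
  proof (intro mult_left_mono mult_right_mono)
    have "card (J - S) + card S = card ((J - S) \<union> S)" by (subst card_Un_disjoint) auto
    also have "\<dots> \<le> CARD('p)" by (intro card_mono) auto
    \<comment> \<open>Passing to the square lets a whole factor \<open>p\<close> leave the root; the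
      small mass \<open>\<kappa>\<close> of the wrong supports pays for it.\<close>
    also have "\<dots> \<le> CARD('p)\<^sup>2" by (simp add: power2_eq_square)
    finally show "real (card (J - S) + card S) \<le> (real CARD('p))\<^sup>2"
      by (metis of_nat_le_iff of_nat_power)
  qed (use c L_pos in auto)
  also have "\<dots> = (real CARD('p) * (\<sigma> * sqrt ((20 + 4 * c) * L)))\<^sup>2"
    using c L_pos by (simp add: power_mult_distrib mult_ac)
  finally show ?thesis by (rule power2_le_imp_le) (use sigma c L_pos in auto)
qed

lemma kappa_mult_p: "\<kappa> * real CARD('p) = real CARD('p) powr (- (4 * c / 3)) * (2 * real CARD('p) powr (- 3))"
  using card_p powr_add[of "real CARD('p)" 1 "- (1 + 4 * c / 3)"] by (simp add: \<kappa>_def mult_ac)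

lemma kappa_mult_p_le: "\<kappa> * real CARD('p) \<le> real CARD('p) powr (- c)"
proof -
  have "\<kappa> * real CARD('p) \<le> real CARD('p) powr (- (4 * c / 3)) * 1"
    unfolding kappa_mult_p by (intro mult_left_mono p_powr_minus_3) auto
  also have "\<dots> \<le> real CARD('p) powr (- c)" using powr_p_le[of "- (4 * c / 3)" "- c"] c by simp
  finally show ?thesis .
qed

lemma kappa_nonneg: "0 \<le> \<kappa>" by (simp add: \<kappa>_def)

lemma kappa_le: "\<kappa> \<le> real CARD('p) powr (- c)"
proof -
  have "\<kappa> * 1 \<le> \<kappa> * real CARD('p)" using card_p by (intro mult_left_mono kappa_nonneg) auto
  then show ?thesis using kappa_mult_p_le by simp
qed

end

section \<open>Estimation error\<close>

lemma infnorm_le: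
  fixes x :: "real^'n"
  assumes "\<And>j. \<bar>x $ j\<bar> \<le> K" shows "infnorm x \<le> K"
  unfolding infnorm_cart by (rule cSup_least) (use assms in auto)

lemma posterior_large: "card J > sbar \<Longrightarrow> posterior X \<sigma> lam sbar v J = 0"
  by (simp add: posterior_def post_weight_def prior_def prior_weight_def)

text \<open>Supports larger than \<open>sbar\<close> have no mass, so the rank conditions of (2) and
  (3) reach every \<open>beta_hat\<close> that matters.\<close>

lemma beta_mean_eq:
  "beta_mean X \<sigma> lam sbar v = (\<Sum>J | card J \<le> sbar. posterior X \<sigma> lam sbar v J *\<^sub>R beta_hat X J v)"
  unfolding beta_mean_def by (rule sum.mono_neutral_right) (auto simp: posterior_large)

context good_noise
begin

text \<open>Least squares on \<open>S\<close> recovers \<open>\<beta>\<close> from the noiseless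
  signal, so by linearity the error is the estimator applied to the noise.\<close>

lemma beta_hat_S_error:
  "\<bar>(beta_hat X S y - \<beta>) $ j\<bar> \<le> \<sigma> * sqrt (2 * (c + 1) * L / (real CARD('n) * (nu X (real s))\<^sup>2))"
proof -
  have "1 \<le> card S" "real (card S) \<le> real s" using s s_def by auto
  then have le: "nu X (real s) \<le> nu_set X S" by (rule nu_le_nu_set)
  have "1 * real s \<le> (2 + \<epsilon>) * real s" using eps by (intro mult_right_mono) auto
  then have "cond_I X (real s)" using I by (auto simp: cond_I_def)
  then have pos: "nu X (real s) > 0" by (rule nu_pos) (use s in auto)
  have "beta_hat X S m = \<beta>"
    by (rule inj_cols_unique[OF inj_cols_S supp_beta_hat[OF inj_cols_S] subset_refl])
      (simp add: mult_beta_hat[OF inj_cols_S] P_m)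
  then have "beta_hat X S y - \<beta> = beta_hat X S z"
    by (simp add: linear_add[OF linear_beta_hat[OF inj_cols_S]])
  then have "\<bar>(beta_hat X S y - \<beta>) $ j\<bar> \<le> \<sigma> * sqrt (2 * (c + 1) * L) / (sqrt (real CARD('n)) * nu_set X S)"
    using noise_coord by simp
  also have "\<dots> \<le> \<sigma> * sqrt (2 * (c + 1) * L) / (sqrt (real CARD('n)) * nu X (real s))"
    using le pos sigma c L_pos by (intro divide_left_mono mult_left_mono mult_pos_pos) auto
  also have "\<dots> = \<sigma> * sqrt (2 * (c + 1) * L / (real CARD('n) * (nu X (real s))\<^sup>2))"
    using pos by (simp add: real_sqrt_divide real_sqrt_mult)
  finally show ?thesis .
qed

text \<open>The posterior weights sum to 1, so the error is a convex combination of individual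
  errors in which a support outside \<open>G\<close> acts as the zero estimator. This covers
  \<open>beta_tilde\<close> and \<open>beta_mean\<close> together.\<close>

lemma mixture_error:
  assumes "S \<in> G"
  shows "\<bar>((\<Sum>J\<in>G. \<rho> J *\<^sub>R beta_hat X J y) - \<beta>) $ j\<bar>
    \<le> \<sigma> * sqrt (2 * (c + 1) * L / (real CARD('n) * (nu X (real s))\<^sup>2))
      + (\<Sum>J\<in>UNIV - {S}. \<rho> J * \<bar>((if J \<in> G then beta_hat X J y else 0) - \<beta>) $ j\<bar>)"
proof -
  define b where "b J = (if J \<in> G then beta_hat X J y else 0) - \<beta>" for J
  have "(\<Sum>J\<in>G. \<rho> J *\<^sub>R beta_hat X J y) = (\<Sum>J\<in>UNIV. \<rho> J *\<^sub>R (if J \<in> G then beta_hat X J y else 0))"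
    by (rule sum.mono_neutral_cong_left) auto
  moreover have "\<beta> = (\<Sum>J\<in>UNIV. \<rho> J *\<^sub>R \<beta>)"
    using posterior_sum by (simp flip: scaleR_left.sum)
  ultimately have "(\<Sum>J\<in>G. \<rho> J *\<^sub>R beta_hat X J y) - \<beta> = (\<Sum>J\<in>UNIV. \<rho> J *\<^sub>R b J)"
    unfolding b_def scaleR_diff_right sum_subtractf by argo
  then have "\<bar>((\<Sum>J\<in>G. \<rho> J *\<^sub>R beta_hat X J y) - \<beta>) $ j\<bar> = \<bar>\<Sum>J\<in>UNIV. \<rho> J * b J $ j\<bar>" by simp
  also have "\<dots> \<le> (\<Sum>J\<in>UNIV. \<bar>\<rho> J * b J $ j\<bar>)" by (rule sum_abs)
  also have "\<dots> = (\<Sum>J\<in>UNIV. \<rho> J * \<bar>b J $ j\<bar>)" by (simp add: abs_mult posterior_nonneg)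
  also have "\<dots> = \<rho> S * \<bar>b S $ j\<bar> + (\<Sum>J\<in>UNIV - {S}. \<rho> J * \<bar>b J $ j\<bar>)"
    by (rule sum.remove) auto
  also have "\<rho> S * \<bar>b S $ j\<bar> \<le> 1 * \<bar>b S $ j\<bar>" by (intro mult_right_mono posterior_S_le) auto
  also have "1 * \<bar>b S $ j\<bar> \<le> \<sigma> * sqrt (2 * (c + 1) * L / (real CARD('n) * (nu X (real s))\<^sup>2))"
    using beta_hat_S_error[of j] assms by (simp add: b_def)
  finally show ?thesis by (simp add: b_def)
qed

text \<open>Serves (1) with \<open>N = nu_min X\<close> and (2) with
  \<open>N = nu X (real sbar)\<close>. The triangle inequality separates \<open>beta_hat\<close>
  from \<open>\<beta>\<close>, and the former is bounded through its image, the projected data. Only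
  the noise carries a factor \<open>p\<close>, so \<open>\<kappa> * p\<close> is compared with
  \<open>p powr (- c)\<close> there and \<open>\<kappa>\<close> elsewhere.\<close>

lemma infnorm_mixture_error:
  assumes "S \<in> G" and N: "N > 0" "\<And>J. J \<in> G \<Longrightarrow> J \<noteq> {} \<Longrightarrow> N \<le> nu_set X J"
  shows "infnorm ((\<Sum>J\<in>G. \<rho> J *\<^sub>R beta_hat X J y) - \<beta>)
    \<le> \<sigma> * sqrt (2 * (c + 1) * L / (real CARD('n) * (nu X (real s))\<^sup>2))
      + 3 / (N * real CARD('p) powr c)
        * (\<sigma> * sqrt ((20 + 4 * c) * (L / real CARD('n))) + norm m / sqrt (real CARD('n)) + N * infnorm \<beta>)"
    (is "_ \<le> ?T + _ * ?B")
proof (rule infnorm_le)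
  fix j
  define Q where "Q = \<sigma> * sqrt ((20 + 4 * c) * L)"
  define D where "D = sqrt (real CARD('n)) * N"
  have D: "D > 0" using N by (simp add: D_def)
  have Q: "Q \<ge> 0" using sigma c L_pos by (simp add: Q_def)
  define H where "H = (real CARD('p) * Q + norm m) / D + infnorm \<beta>"
  have \<beta>j: "\<bar>\<beta> $ j\<bar> \<le> infnorm \<beta>" by (rule component_le_infnorm_cart)
  have "\<bar>((if J \<in> G then beta_hat X J y else 0) - \<beta>) $ j\<bar> \<le> H" for J
  proof (cases "J \<in> G \<and> J \<noteq> {}")
    case True
    then have nu: "N \<le> nu_set X J" using N by auto
    then have inj: "inj_cols X J" using N by (intro inj_cols_of_nu_set_pos) auto
    have "D * norm (beta_hat X J y) \<le> sqrt (real CARD('n)) * nu_set X J * norm (beta_hat X J y)"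
      unfolding D_def by (intro mult_right_mono mult_left_mono nu) auto
    also have "\<dots> \<le> norm (X *v beta_hat X J y)" by (rule nu_set_bound[OF supp_beta_hat[OF inj]])
    also have "\<dots> = norm (P J m + P J z)"
      by (simp add: mult_beta_hat[OF inj] linear_add[OF linear_orth_proj[OF subspace_span]])
    also have "\<dots> \<le> norm m + real CARD('p) * Q"
      unfolding Q_def
      by (intro order_trans[OF norm_triangle_ineq] add_mono norm_orth_proj_le subspace_span norm_proj_noise_le)
    finally have "norm (beta_hat X J y) \<le> (real CARD('p) * Q + norm m) / D" using D by (simp add: field_simps)
    moreover have "\<bar>beta_hat X J y $ j\<bar> \<le> norm (beta_hat X J y)" by (rule component_le_norm_cart)
    ultimately show ?thesis using True \<beta>j by (simp add: H_def)
  next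
    case False
    then have "(if J \<in> G then beta_hat X J y else 0) = 0" by (auto simp: beta_hat_empty)
    moreover have "0 \<le> (real CARD('p) * Q + norm m) / D" using D Q by simp
    ultimately show ?thesis using \<beta>j by (simp add: H_def)
  qed
  then have "(\<Sum>J\<in>UNIV - {S}. \<rho> J * \<bar>((if J \<in> G then beta_hat X J y else 0) - \<beta>) $ j\<bar>)
    \<le> (\<Sum>J\<in>UNIV - {S}. \<rho> J * H)"
    by (intro sum_mono mult_left_mono posterior_nonneg)
  also have "\<dots> = (\<Sum>J\<in>UNIV - {S}. \<rho> J) * H" by (simp add: sum_distrib_right)
  also have "\<dots> \<le> \<kappa> * H"
    using D Q by (intro mult_right_mono sum_posterior_wrong_le) (auto simp: H_def infnorm_pos_le)
  also have "\<dots> = (\<kappa> * real CARD('p) * Q + \<kappa> * norm m) / D + \<kappa> * infnorm \<beta>"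
    by (simp add: H_def algebra_simps)
  also have "\<dots> \<le> (real CARD('p) powr (- c) * Q + real CARD('p) powr (- c) * norm m) / D
      + real CARD('p) powr (- c) * infnorm \<beta>"
    using D Q by (intro add_mono divide_right_mono mult_right_mono kappa_mult_p_le kappa_le)
      (auto simp: infnorm_pos_le)
  also have "\<dots> = 1 / (N * real CARD('p) powr c) * ?B"
    using N card_p unfolding Q_def D_def powr_minus
    by (simp add: real_sqrt_divide real_sqrt_mult field_simps)
  also have "\<dots> \<le> 3 / (N * real CARD('p) powr c) * ?B"
    using N sigma c L_pos by (intro mult_right_mono divide_right_mono add_nonneg_nonneg mult_nonneg_nonneg)
      (auto simp: infnorm_pos_le)
  finally show "\<bar>((\<Sum>J\<in>G. \<rho> J *\<^sub>R beta_hat X J y) - \<beta>) $ j\<bar> \<le> ?T + 3 / (N * real CARD('p) powr c) * ?B"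
    using mixture_error[OF assms(1), of j] by linarith
qed

text \<open>The surplus of \<open>\<kappa> * p\<close> over \<open>p powr (- c)\<close> is used up
  as follows: \<open>p powr (- c / 3)\<close> absorbs \<open>sqrt (20 + 4 * c)\<close> uniformly in
  \<open>c\<close>, and \<open>p powr (- 3)\<close> absorbs the factor 2 and
  \<open>sqrt L \<le> p\<close>.\<close>

lemma kappa_noise_bound: "\<kappa> * (real CARD('p) * sqrt ((20 + 4 * c) * L)) \<le> 5 * real CARD('p) powr (- c)"
proof -
  let ?p = "real CARD('p)"
  have "ln 2 \<le> L" unfolding L_def using card_p by (subst ln_le_cancel_iff) auto
  then have L1: "L \<ge> 2 / 3" using ln2_ge_two_thirds by linarith
  have LP: "L \<le> ?p" unfolding L_def using ln_le_minus_one[of ?p] card_p by simp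
  \<comment> \<open>Multiplied by 25, the left side is \<open>25 + 100 * c / 9\<close>, which
    exceeds \<open>20 + 4 * c\<close>.\<close>
  have "1 + 4 * c / 9 \<le> 1 + 2 * c / 3 * L" using mult_left_mono[OF L1, of "2 * c / 3"] c by simp
  also have "\<dots> \<le> ?p powr (2 * c / 3)" unfolding powr_p by (rule exp_ge_add_one_self)
  finally have "20 + 4 * c \<le> 25 * ?p powr (2 * c / 3)" using c by simp
  also have "\<dots> = (5 * ?p powr (c / 3))\<^sup>2"
    by (simp add: power_mult_distrib power2_eq_square flip: powr_add)
  finally have 1: "20 + 4 * c \<le> (5 * ?p powr (c / 3))\<^sup>2" .
  have "(20 + 4 * c) * L \<le> (5 * ?p powr (c / 3))\<^sup>2 * ?p\<^sup>2"
  proof (rule mult_mono[OF 1])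
    have "?p * 1 \<le> ?p * ?p" using card_p by (intro mult_left_mono) auto
    with LP show "L \<le> ?p\<^sup>2" unfolding power2_eq_square by linarith
  qed (use c L_pos in auto)
  then have "sqrt ((20 + 4 * c) * L) \<le> 5 * ?p powr (c / 3) * ?p"
    by (intro real_le_lsqrt) (auto simp: power_mult_distrib)
  then have "\<kappa> * ?p * sqrt ((20 + 4 * c) * L) \<le> \<kappa> * ?p * (5 * ?p powr (c / 3) * ?p)"
    by (intro mult_left_mono mult_nonneg_nonneg kappa_nonneg) auto
  also have "\<dots> = 5 * (?p powr (- (4 * c / 3)) * ?p powr (c / 3)) * (2 * (?p powr (- 3) * ?p))"
    unfolding kappa_mult_p by simp
  also have "?p powr (- (4 * c / 3)) * ?p powr (c / 3) = ?p powr (- c)" by (simp flip: powr_add)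
  also have "?p powr (- 3) * ?p = ?p powr (- 2)" using card_p powr_add[of ?p "- 3" 1] by simp
  also have "5 * ?p powr (- c) * (2 * ?p powr (- 2)) \<le> 5 * ?p powr (- c) * 1"
  proof (rule mult_left_mono)
    have "?p powr (- 2) \<le> ?p powr (- 1)" by (rule powr_p_le) simp
    also have "\<dots> \<le> 1 / 2" using card_p by (simp add: powr_minus divide_simps)
    finally show "2 * ?p powr (- 2) \<le> 1" by simp
  qed auto
  finally show ?thesis by simp
qed

text \<open>The difference \<open>beta_hat X J y - \<beta>\<close> is treated as one vector
  supported in \<open>J \<union> S\<close>: its image under \<open>X\<close> is
  \<open>P J z - bias J\<close>, so the bias takes the place of the whole signal. The union can have
  \<open>s + sbar\<close> elements, hence the order at which \<open>nu\<close> is taken.\<close>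

lemma infnorm_beta_mean_error:
  assumes I2: "cond_I X (real (s + sbar))"
  shows "infnorm (beta_mean X \<sigma> lam sbar y - \<beta>)
    \<le> \<sigma> * sqrt (2 * (c + 1) * L / (real CARD('n) * (nu X (real s))\<^sup>2))
      + 2 * sqrt 10 * \<sigma> / (sqrt (real CARD('n)) * nu X (real (s + sbar)))
        * (2 * sqrt (real s) / real CARD('p) powr c + 1 / real CARD('p) ^ s)"
    (is "_ \<le> ?T + ?C * ?B")
proof (rule infnorm_le)
  fix j
  define D where "D = sqrt (real CARD('n)) * nu X (real (s + sbar))"
  define Q where "Q = real CARD('p) * (\<sigma> * sqrt ((20 + 4 * c) * L))"
  have nupos: "nu X (real (s + sbar)) > 0" by (rule nu_pos[OF I2]) (use s in auto)
  then have D: "D > 0" by (simp add: D_def)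
  let ?G = "{J. card J \<le> sbar}"
  have SG: "S \<in> ?G" using s s_def by simp
  have "\<rho> J * \<bar>((if J \<in> ?G then beta_hat X J y else 0) - \<beta>) $ j\<bar> \<le> \<rho> J * ((Q + norm (bias J)) / D)" for J
  proof (cases "J \<in> ?G")
    case True
    then have inj: "inj_cols X J" by (intro cond_I_inj_cols[OF I2]) simp
    have cK: "card (J \<union> S) \<le> s + sbar" using card_Un_le[of J S] True by (simp add: s_def)
    have "card S \<le> card (J \<union> S)" by (intro card_mono) auto
    then have "1 \<le> card (J \<union> S)" using s s_def by simp
    then have nu: "nu X (real (s + sbar)) \<le> nu_set X (J \<union> S)" using cK by (intro nu_le_nu_set) auto
    have sup: "supp (beta_hat X J y - \<beta>) \<subseteq> J \<union> S"
      using supp_diff_subset[of "beta_hat X J y" \<beta>] supp_beta_hat[OF inj, of y] by auto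
    have "D * norm (beta_hat X J y - \<beta>) \<le> sqrt (real CARD('n)) * nu_set X (J \<union> S) * norm (beta_hat X J y - \<beta>)"
      unfolding D_def by (intro mult_right_mono mult_left_mono nu) auto
    also have "\<dots> \<le> norm (X *v (beta_hat X J y - \<beta>))" by (rule nu_set_bound[OF sup])
    also have "X *v (beta_hat X J y - \<beta>) = P J z - bias J"
      by (simp add: matrix_vector_mult_diff_distrib mult_beta_hat[OF inj] bias_def
          linear_add[OF linear_orth_proj[OF subspace_span]])
    also have "norm \<dots> \<le> Q + norm (bias J)"
      unfolding Q_def by (intro order_trans[OF norm_triangle_ineq4] add_mono norm_proj_noise_le order_refl)
    finally have "norm (beta_hat X J y - \<beta>) \<le> (Q + norm (bias J)) / D" using D by (simp add: field_simps)
    moreover have "\<bar>(beta_hat X J y - \<beta>) $ j\<bar> \<le> norm (beta_hat X J y - \<beta>)" by (rule component_le_norm_cart)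
    ultimately show ?thesis using True by (intro mult_left_mono posterior_nonneg) simp
  qed (simp add: posterior_large)
  then have "(\<Sum>J\<in>UNIV - {S}. \<rho> J * \<bar>((if J \<in> ?G then beta_hat X J y else 0) - \<beta>) $ j\<bar>)
    \<le> (\<Sum>J\<in>UNIV - {S}. \<rho> J * ((Q + norm (bias J)) / D))"
    by (rule sum_mono)
  also have "\<dots> = ((\<Sum>J\<in>UNIV - {S}. \<rho> J) * Q + (\<Sum>J\<in>UNIV - {S}. \<rho> J * norm (bias J))) / D"
    by (simp add: sum_distrib_right sum_divide_distrib distrib_left add_divide_distrib sum.distrib)
  also have "\<dots> \<le> (\<kappa> * Q + 2 * \<sigma> * \<kappa>) / D"
    using D sigma c L_pos
    by (intro divide_right_mono add_mono mult_right_mono sum_posterior_wrong_le sum_posterior_bias_le)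
      (auto simp: Q_def)
  also have "\<dots> \<le> (\<sigma> * (5 * real CARD('p) powr (- c)) + 2 * \<sigma> * real CARD('p) powr (- c)) / D"
  proof (intro divide_right_mono add_mono)
    have "\<kappa> * Q = \<sigma> * (\<kappa> * (real CARD('p) * sqrt ((20 + 4 * c) * L)))" by (simp add: Q_def)
    also have "\<dots> \<le> \<sigma> * (5 * real CARD('p) powr (- c))"
      using sigma by (intro mult_left_mono kappa_noise_bound) auto
    finally show "\<kappa> * Q \<le> \<sigma> * (5 * real CARD('p) powr (- c))" .
    show "2 * \<sigma> * \<kappa> \<le> 2 * \<sigma> * real CARD('p) powr (- c)"
      using sigma by (intro mult_left_mono kappa_le) auto
  qed (use D in auto)
  also have "\<dots> = (7 * \<sigma> / D) * (1 / real CARD('p) powr c)"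
    by (simp add: powr_minus field_simps)
  also have "\<dots> \<le> ((2 * sqrt 10 * \<sigma>) / D) * ?B"
  proof -
    have s10: "(3::real) \<le> sqrt 10" by (rule real_le_rsqrt) simp
    \<comment> \<open>The noise and bias constants \<open>5 + 2\<close> fit below
      \<open>12 = 2 * 3 * 2\<close>, where 3 is raised to \<open>sqrt 10\<close> and the last factor
      2 to \<open>2 * sqrt s\<close>.\<close>
    have "7 * (1 / real CARD('p) powr c) \<le> 12 * (1 / real CARD('p) powr c)" by (simp add: divide_right_mono)
    also have "\<dots> = (2 * 3) * (2 * 1 / real CARD('p) powr c)" by simp
    also have "\<dots> \<le> (2 * sqrt 10) * ?B"
      using s10 s(1) by (intro mult_mono add_increasing2 divide_right_mono) auto
    finally have "7 * (1 / real CARD('p) powr c) * (\<sigma> / D) \<le> (2 * sqrt 10) * ?B * (\<sigma> / D)"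
      using sigma D by (intro mult_right_mono) auto
    then show ?thesis by (simp add: mult_ac)
  qed
  finally show "\<bar>(beta_mean X \<sigma> lam sbar y - \<beta>) $ j\<bar> \<le> ?T + ?C * ?B"
    using mixture_error[OF SG, of j] unfolding beta_mean_eq D_def by linarith
qed

end

section \<open>Measurability of the estimators\<close>

lemma borel_measurable_linear:
  fixes f :: "'a::euclidean_space \<Rightarrow> 'b::euclidean_space"
  assumes "linear f" shows "f \<in> borel_measurable borel"
  using assms by (intro borel_measurable_continuous_onI linear_continuous_on) (simp add: linear_conv_bounded_linear)

lemma borel_measurable_posterior [measurable]:
  fixes X :: "real^'p^'n"
  shows "(\<lambda>v. posterior X \<sigma> lam sbar v J) \<in> borel_measurable borel"
proof -
  have [measurable]: "resid X K \<in> borel_measurable borel" for K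
    by (rule borel_measurable_linear[OF linear_resid])
  show ?thesis unfolding posterior_def post_weight_def by measurable
qed

text \<open>The events of the theorem must be measurable for their probability to dominate that of
  the good event. On supports with independent columns each \<open>beta_hat\<close> is linear, hence
  Borel.\<close>

lemma borel_measurable_mixture:
  fixes X :: "real^'p^'n"
  assumes "\<And>J. J \<in> G \<Longrightarrow> inj_cols X J"
  shows "(\<lambda>v. \<Sum>J\<in>G. posterior X \<sigma> lam sbar v J *\<^sub>R beta_hat X J v) \<in> borel_measurable borel"
proof (intro borel_measurable_sum borel_measurable_scaleR borel_measurable_posterior)
  fix J assume "J \<in> G"
  then show "beta_hat X J \<in> borel_measurable borel"
    by (intro borel_measurable_linear linear_beta_hat assms)
qed

theorem theorem5:
  fixes X :: "real^'p^'n"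
    and M :: "'a measure"
    and y z :: "'a \<Rightarrow> real^'n"
    and \<beta> :: "real^'p"
    and \<sigma> lam \<epsilon> c :: real
    and s sbar :: nat
  assumes pn: "CARD('n) \<le> CARD('p)"
    and cols: "\<And>j. norm (column j X) = sqrt (real CARD('n))"
    and M: "prob_space M"
    and sigma: "\<sigma> > 0"
    and z: "isotropic_gaussian M z \<sigma>"
    and y: "y = (\<lambda>\<omega>. X *v \<beta> + z \<omega>)"
    and sparsest: "sparsest_solution X (\<integral>\<omega>. y \<omega> \<partial>M) \<beta>"
    and s_def: "s = card (supp \<beta>)"
    and s: "1 \<le> s" "s \<le> sbar" "sbar \<le> CARD('p)"
    and lambda_pos: "lam > 0"
    and eps: "\<epsilon> > 0"
    and c: "c \<ge> 1"
    and I: "cond_I X ((2 + \<epsilon>) * real s)"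
    and lambda: "lam = ((1 + \<epsilon>) * (23 + 5 * c) + 1) / \<epsilon> * ln (real CARD('p))"
    and beta_min: "Min ((\<lambda>j. \<bar>\<beta> $ j\<bar>) ` supp \<beta>)
          \<ge> 3 * \<sigma> * sqrt (lam / real CARD('n)) / nu X ((2 + \<epsilon>) * real s)"
  shows "measure M {\<omega> \<in> space M.
            infnorm (beta_tilde X \<sigma> lam sbar (y \<omega>) - \<beta>)
              \<le> \<sigma> * sqrt (2 * (c + 1) * ln (real CARD('p)) / (real CARD('n) * (nu X (real s))\<^sup>2))
                + 3 / (nu_min X * real CARD('p) powr c)
                  * (\<sigma> * sqrt ((20 + 4 * c) * (ln (real CARD('p)) / real CARD('n)))
                     + norm (X *v \<beta>) / sqrt (real CARD('n))
                     + nu_min X * infnorm \<beta>)}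
          \<ge> 1 - 4 * real CARD('p) powr (- c)
    \<and> (cond_I X (real sbar) \<longrightarrow>
        measure M {\<omega> \<in> space M.
            infnorm (beta_mean X \<sigma> lam sbar (y \<omega>) - \<beta>)
              \<le> \<sigma> * sqrt (2 * (c + 1) * ln (real CARD('p)) / (real CARD('n) * (nu X (real s))\<^sup>2))
                + 3 / (nu X (real sbar) * real CARD('p) powr c)
                  * (\<sigma> * sqrt ((20 + 4 * c) * (ln (real CARD('p)) / real CARD('n)))
                     + norm (X *v \<beta>) / sqrt (real CARD('n))
                     + nu X (real sbar) * infnorm \<beta>)}
          \<ge> 1 - 4 * real CARD('p) powr (- c))
    \<and> (cond_I X (real (s + sbar)) \<and> lam \<ge> (62 + 4 * c) * ln (real CARD('p)) \<longrightarrow>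
        measure M {\<omega> \<in> space M.
            infnorm (beta_mean X \<sigma> lam sbar (y \<omega>) - \<beta>)
              \<le> \<sigma> * sqrt (2 * (c + 1) * ln (real CARD('p)) / (real CARD('n) * (nu X (real s))\<^sup>2))
                + 2 * sqrt 10 * \<sigma> / (sqrt (real CARD('n)) * nu X (real (s + sbar)))
                  * (2 * sqrt (real s) / real CARD('p) powr c + 1 / real CARD('p) ^ s)}
          \<ge> 1 - 4 * real CARD('p) powr (- c))"
proof -
  interpret prob_space M by (rule M)
  define L where "L = ln (real CARD('p))"
  \<comment> \<open>The case \<open>p = 1\<close> is excluded by \<open>lam > 0\<close>, since it
    would make \<open>lam\<close> zero.\<close>
  have "ln (real CARD('p)) \<noteq> 0" using lambda lambda_pos by auto
  then have "CARD('p) \<noteq> 1" by auto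
  then have p2: "2 \<le> CARD('p)" using s by linarith
  interpret sparse_model X \<beta> \<sigma> lam \<epsilon> c L s sbar
    by unfold_locales (use L_def sigma s_def s p2 eps c I lambda beta_min in auto)
  obtain E where E: "E \<in> events" "prob E \<ge> 1 - 4 * real CARD('p) powr (- c)"
    "\<And>\<omega> j. \<omega> \<in> E \<Longrightarrow> \<bar>beta_hat X S (z \<omega>) $ j\<bar> \<le> \<sigma> * sqrt (2 * (c + 1) * L) / (sqrt (real CARD('n)) * nu_set X S)"
    "\<And>\<omega> J. \<omega> \<in> E \<Longrightarrow> J \<noteq> S \<Longrightarrow> - (bias J \<bullet> z \<omega>) \<le> \<sigma> * norm (bias J) * sqrt ((2 * c + 6) * real (dist_S J) * L)"
    "\<And>\<omega> R. \<omega> \<in> E \<Longrightarrow> (norm (P (S \<union> R) (z \<omega>)))\<^sup>2 - (norm (P S (z \<omega>)))\<^sup>2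
       \<le> \<sigma>\<^sup>2 * (8 / 3 * (c + 4) * real (card R) * L)"
    "\<And>\<omega>. \<omega> \<in> E \<Longrightarrow> (norm (P S (z \<omega>)))\<^sup>2 \<le> \<sigma>\<^sup>2 * (8 / 3 * (c + 1) * real (card S) * L)"
    \<comment> \<open>The family \<open>bias\<close> is built from \<open>X\<close> and
      \<open>\<beta>\<close> only, so it is fixed before the noise.\<close>
    using good_event[OF z sigma c p2 S_nonempty nu_set_S_pos, of bias] unfolding L_def by blast
  have gn: "good_noise X \<beta> \<sigma> lam \<epsilon> c L s sbar (z \<omega>)" if "\<omega> \<in> E" for \<omega>
    by unfold_locales (use E(3-6)[OF that] in auto)
  have ym [measurable]: "y \<in> borel_measurable M"
    unfolding y using isotropic_gaussian_measurable[OF z] by simp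
  \<comment> \<open>Reduces each of the three claims to measurability of its estimator and a
    deterministic bound at the points of \<open>E\<close>.\<close>
  have main: "prob {\<omega> \<in> space M. infnorm (f \<omega> - \<beta>) \<le> K} \<ge> 1 - 4 * real CARD('p) powr (- c)"
    if f [measurable]: "f \<in> borel_measurable M" and K: "\<And>\<omega>. \<omega> \<in> E \<Longrightarrow> infnorm (f \<omega> - \<beta>) \<le> K" for f K
  proof -
    have [measurable]: "(infnorm :: real^'p \<Rightarrow> real) \<in> borel_measurable borel"
      by (intro borel_measurable_continuous_onI continuous_on_infnorm continuous_on_id)
    have "prob E \<le> prob {\<omega> \<in> space M. infnorm (f \<omega> - \<beta>) \<le> K}"
    proof (rule finite_measure_mono)
      show "E \<subseteq> {\<omega> \<in> space M. infnorm (f \<omega> - \<beta>) \<le> K}" using K sets.sets_into_space[OF E(1)] by auto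
    qed measurable
    then show ?thesis using E(2) by linarith
  qed
  have meanm: "(\<lambda>\<omega>. beta_mean X \<sigma> lam sbar (y \<omega>)) \<in> borel_measurable M" if "cond_I X r" "real sbar \<le> r" for r
    unfolding beta_mean_eq
    by (rule measurable_compose[OF ym borel_measurable_mixture])
      (use that in \<open>auto intro!: cond_I_inj_cols[OF that(1)]\<close>)
  show ?thesis
  proof (intro conjI impI)
    let ?G = "{J. J \<noteq> {} \<and> nu_set X J > 0}"
    show "1 - 4 * real CARD('p) powr (- c) \<le> prob {\<omega> \<in> space M. infnorm (beta_tilde X \<sigma> lam sbar (y \<omega>) - \<beta>)
              \<le> \<sigma> * sqrt (2 * (c + 1) * ln (real CARD('p)) / (real CARD('n) * (nu X (real s))\<^sup>2))
                + 3 / (nu_min X * real CARD('p) powr c)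
                  * (\<sigma> * sqrt ((20 + 4 * c) * (ln (real CARD('p)) / real CARD('n)))
                     + norm (X *v \<beta>) / sqrt (real CARD('n))
                     + nu_min X * infnorm \<beta>)}"
    proof (rule main)
      show "(\<lambda>\<omega>. beta_tilde X \<sigma> lam sbar (y \<omega>)) \<in> borel_measurable M"
        unfolding beta_tilde_def
        by (rule measurable_compose[OF ym borel_measurable_mixture]) (auto intro: inj_cols_of_nu_set_pos)
      fix \<omega> assume "\<omega> \<in> E"
      then interpret good_noise X \<beta> \<sigma> lam \<epsilon> c L s sbar "z \<omega>" by (rule gn)
      show "infnorm (beta_tilde X \<sigma> lam sbar (y \<omega>) - \<beta>)
              \<le> \<sigma> * sqrt (2 * (c + 1) * ln (real CARD('p)) / (real CARD('n) * (nu X (real s))\<^sup>2))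
                + 3 / (nu_min X * real CARD('p) powr c)
                  * (\<sigma> * sqrt ((20 + 4 * c) * (ln (real CARD('p)) / real CARD('n)))
                     + norm (X *v \<beta>) / sqrt (real CARD('n))
                     + nu_min X * infnorm \<beta>)"
        unfolding beta_tilde_def y L_def[symmetric]
        by (rule infnorm_mixture_error)
          (use S_nonempty nu_set_S_pos nu_min_pos[OF S_nonempty nu_set_S_pos] in \<open>auto intro: nu_min_le\<close>)
    qed
  next
    assume I2: "cond_I X (real sbar)"
    show "1 - 4 * real CARD('p) powr (- c) \<le> prob {\<omega> \<in> space M. infnorm (beta_mean X \<sigma> lam sbar (y \<omega>) - \<beta>)
              \<le> \<sigma> * sqrt (2 * (c + 1) * ln (real CARD('p)) / (real CARD('n) * (nu X (real s))\<^sup>2))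
                + 3 / (nu X (real sbar) * real CARD('p) powr c)
                  * (\<sigma> * sqrt ((20 + 4 * c) * (ln (real CARD('p)) / real CARD('n)))
                     + norm (X *v \<beta>) / sqrt (real CARD('n))
                     + nu X (real sbar) * infnorm \<beta>)}"
    proof (rule main[OF meanm[OF I2 order_refl]])
      fix \<omega> assume "\<omega> \<in> E"
      then interpret good_noise X \<beta> \<sigma> lam \<epsilon> c L s sbar "z \<omega>" by (rule gn)
      show "infnorm (beta_mean X \<sigma> lam sbar (y \<omega>) - \<beta>)
              \<le> \<sigma> * sqrt (2 * (c + 1) * ln (real CARD('p)) / (real CARD('n) * (nu X (real s))\<^sup>2))
                + 3 / (nu X (real sbar) * real CARD('p) powr c)
                  * (\<sigma> * sqrt ((20 + 4 * c) * (ln (real CARD('p)) / real CARD('n)))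
                     + norm (X *v \<beta>) / sqrt (real CARD('n))
                     + nu X (real sbar) * infnorm \<beta>)"
        unfolding y beta_mean_eq L_def[symmetric]
      proof (rule infnorm_mixture_error)
        show "nu X (real sbar) > 0" by (rule nu_pos[OF I2]) (use s in simp)
        show "nu X (real sbar) \<le> nu_set X J" if "J \<in> {J. card J \<le> sbar}" "J \<noteq> {}" for J
          using that by (intro nu_le_nu_set) (auto simp: Suc_le_eq card_gt_0_iff)
      qed (use s s_def in simp)
    qed
  next
    assume I3: "cond_I X (real (s + sbar)) \<and> lam \<ge> (62 + 4 * c) * ln (real CARD('p))"
    show "1 - 4 * real CARD('p) powr (- c) \<le> prob {\<omega> \<in> space M. infnorm (beta_mean X \<sigma> lam sbar (y \<omega>) - \<beta>)
              \<le> \<sigma> * sqrt (2 * (c + 1) * ln (real CARD('p)) / (real CARD('n) * (nu X (real s))\<^sup>2))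
                + 2 * sqrt 10 * \<sigma> / (sqrt (real CARD('n)) * nu X (real (s + sbar)))
                  * (2 * sqrt (real s) / real CARD('p) powr c + 1 / real CARD('p) ^ s)}"
    proof (rule main[OF meanm])
      show "cond_I X (real (s + sbar))" using I3 by simp
      show "real sbar \<le> real (s + sbar)" by simp
      fix \<omega> assume "\<omega> \<in> E"
      then interpret good_noise X \<beta> \<sigma> lam \<epsilon> c L s sbar "z \<omega>" by (rule gn)
      show "infnorm (beta_mean X \<sigma> lam sbar (y \<omega>) - \<beta>)
              \<le> \<sigma> * sqrt (2 * (c + 1) * ln (real CARD('p)) / (real CARD('n) * (nu X (real s))\<^sup>2))
                + 2 * sqrt 10 * \<sigma> / (sqrt (real CARD('n)) * nu X (real (s + sbar)))
                  * (2 * sqrt (real s) / real CARD('p) powr c + 1 / real CARD('p) ^ s)"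
        unfolding y L_def[symmetric] using I3 by (intro infnorm_beta_mean_error) simp
    qed
  qed
qed

end
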